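(* Let $(M,g)$ be an $n$-dimensional Riemannian manifold, $n\geq 3$, and let $(V,\lambda)$ define a gradient almost Riemann soliton on $(M,g)$. Then $$\lambda=\frac{1}{2(n-1)|V|^2}\left[\Delta(|V|^2)-2|\nabla V|^2+(n-2)V(|V|^2)-2V(\operatorname{div}(V))\right]+\frac{1}{n-1}\operatorname{div}(V).$$
   Context: Conventions: for $(0,2)$-tensor fields, the Kulkarni-Nomizu product is $(T_1\odot T_2)(X,Y,Z,W)=T_1(X,W)T_2(Y,Z)+T_1(Y,Z)T_2(X,W)-T_1(X,Z)T_2(Y,W)-T_1(Y,W)T_2(X,Z)$. $R$ is the $(0,4)$ Riemann curvature tensor $R(X,Y,Z,W)=g(R(X,Y)Z,W)$, with $R(X,Y)Z=\nabla_X\nabla_YZ-\nabla_Y\nabla_XZ-\nabla_{[X,Y]}Z$ and $\nabla$ the Levi-Civita connection. $G:=\frac12 g\odot g$. Let $V$ be a non-vanishing (nowhere zero) smooth vector field and $\lambda$ a smooth function on $M$. $(V,\lambda)$ defines an almost Riemann soliton on $(M,g)$ if $\frac12(\pounds_Vg)\odot g+R=\lambda G$, where $\pounds_V$ is the Lie derivative. It is a gradient almost Riemann soliton if moreover $V=\operatorname{grad}(f)$ for some smooth function $f$ on $M$. $\Delta=\operatorname{div}\circ\operatorname{grad}$ is the Laplacian, $|\nabla V|^2=\sum_i|\nabla_{E_i}V|^2$ for a local orthonormal frame $\{E_i\}$, and $V(h)$ denotes the derivative of a function $h$ along $V$. *)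

theory Defs
  imports "HOL-Analysis.Analysis"
begin

section \<open>Smooth manifolds\<close>

text \<open>Smoothness on an open subset of a normed space; \<open>Ck_on\<close> is only used on open sets.\<close>

fun Ck_on :: "nat \<Rightarrow> 'b::real_normed_vector set \<Rightarrow> ('b \<Rightarrow> 'c::real_normed_vector) \<Rightarrow> bool" where
  "Ck_on 0 S f \<longleftrightarrow> continuous_on S f"
| "Ck_on (Suc k) S f \<longleftrightarrow>
     (\<forall>x\<in>S. f differentiable (at x)) \<and> (\<forall>v. Ck_on k S (\<lambda>x. frechet_derivative f (at x) v))"

definition smooth_on :: "'b::real_normed_vector set \<Rightarrow> ('b \<Rightarrow> 'c::real_normed_vector) \<Rightarrow> bool" where
  "smooth_on S f \<longleftrightarrow> (\<forall>k. Ck_on k S f)"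

text \<open>The manifold is the whole type \<open>'a\<close>, whose topology is required to be Hausdorff and second
  countable in the statements; its dimension is \<open>CARD('n)\<close>. A chart is a pair \<open>(U, \<phi>)\<close>.
  The atlas need not be maximal.\<close>

type_synonym ('a, 'n) chart = "'a set \<times> ('a \<Rightarrow> real ^ 'n)"

definition smooth_atlas :: "('a::topological_space, 'n::finite) chart set \<Rightarrow> bool" where
  "smooth_atlas A \<longleftrightarrow>
     (\<Union>(U, \<phi>)\<in>A. U) = UNIV \<and>
     (\<forall>(U, \<phi>)\<in>A. open U \<and> open (\<phi> ` U) \<and> homeomorphism U (\<phi> ` U) \<phi> (inv_into U \<phi>)) \<and>
     (\<forall>(U, \<phi>)\<in>A. \<forall>(W, \<psi>)\<in>A. smooth_on (\<phi> ` (U \<inter> W)) (\<psi> \<circ> inv_into U \<phi>))"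

definition smooth_fun :: "('a, 'n::finite) chart set \<Rightarrow> ('a \<Rightarrow> real) \<Rightarrow> bool" where
  "smooth_fun A f \<longleftrightarrow> (\<forall>(U, \<phi>)\<in>A. smooth_on (\<phi> ` U) (f \<circ> inv_into U \<phi>))"


section \<open>Vector fields\<close>

text \<open>Smooth vector fields are the derivations of the algebra of smooth functions, \<open>X h\<close> being the
  derivative of \<open>h\<close> along \<open>X\<close>. The value on non-smooth functions is fixed to be zero, so that
  equality of vector fields is equality of derivations.\<close>

type_synonym 'a vfield = "('a \<Rightarrow> real) \<Rightarrow> 'a \<Rightarrow> real"

definition vector_field :: "('a, 'n::finite) chart set \<Rightarrow> 'a vfield \<Rightarrow> bool" where
  "vector_field A X \<longleftrightarrow>
     (\<forall>f. smooth_fun A f \<longrightarrow> smooth_fun A (X f)) \<and>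
     (\<forall>f h. smooth_fun A f \<longrightarrow> smooth_fun A h \<longrightarrow>
        X (\<lambda>p. f p + h p) = (\<lambda>p. X f p + X h p)) \<and>
     (\<forall>c f. smooth_fun A f \<longrightarrow> X (\<lambda>p. c * f p) = (\<lambda>p. c * X f p)) \<and>
     (\<forall>f h. smooth_fun A f \<longrightarrow> smooth_fun A h \<longrightarrow>
        X (\<lambda>p. f p * h p) = (\<lambda>p. f p * X h p + X f p * h p)) \<and>
     (\<forall>f. \<not> smooth_fun A f \<longrightarrow> X f = (\<lambda>p. 0))"

definition vf_add :: "'a vfield \<Rightarrow> 'a vfield \<Rightarrow> 'a vfield" where
  "vf_add X Y = (\<lambda>h p. X h p + Y h p)"

definition vf_diff :: "'a vfield \<Rightarrow> 'a vfield \<Rightarrow> 'a vfield" where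
  "vf_diff X Y = (\<lambda>h p. X h p - Y h p)"

definition vf_scale :: "('a \<Rightarrow> real) \<Rightarrow> 'a vfield \<Rightarrow> 'a vfield" where
  "vf_scale f X = (\<lambda>h p. f p * X h p)"

definition lie_bracket :: "'a vfield \<Rightarrow> 'a vfield \<Rightarrow> 'a vfield" where
  "lie_bracket X Y = (\<lambda>h p. X (Y h) p - Y (X h) p)"

definition nonzero_at :: "'a vfield \<Rightarrow> 'a \<Rightarrow> bool" where
  "nonzero_at X p \<longleftrightarrow> (\<exists>h. X h p \<noteq> 0)"


section \<open>Riemannian metrics\<close>

text \<open>Covariant tensor fields are maps from vector fields to functions that are multilinear over
  the smooth functions.\<close>

type_synonym 'a tensor2 = "'a vfield \<Rightarrow> 'a vfield \<Rightarrow> 'a \<Rightarrow> real"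
type_synonym 'a tensor4 = "'a vfield \<Rightarrow> 'a vfield \<Rightarrow> 'a vfield \<Rightarrow> 'a vfield \<Rightarrow> 'a \<Rightarrow> real"

definition tensor_field2 :: "('a, 'n::finite) chart set \<Rightarrow> 'a tensor2 \<Rightarrow> bool" where
  "tensor_field2 A T \<longleftrightarrow>
     (\<forall>X Y. vector_field A X \<longrightarrow> vector_field A Y \<longrightarrow> smooth_fun A (T X Y)) \<and>
     (\<forall>X Y Z. vector_field A X \<longrightarrow> vector_field A Y \<longrightarrow> vector_field A Z \<longrightarrow>
        T (vf_add X Y) Z = (\<lambda>p. T X Z p + T Y Z p) \<and>
        T Z (vf_add X Y) = (\<lambda>p. T Z X p + T Z Y p)) \<and>
     (\<forall>f X Y. smooth_fun A f \<longrightarrow> vector_field A X \<longrightarrow> vector_field A Y \<longrightarrow>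
        T (vf_scale f X) Y = (\<lambda>p. f p * T X Y p) \<and>
        T X (vf_scale f Y) = (\<lambda>p. f p * T X Y p))"

definition riemannian_metric :: "('a, 'n::finite) chart set \<Rightarrow> 'a tensor2 \<Rightarrow> bool" where
  "riemannian_metric A g \<longleftrightarrow>
     tensor_field2 A g \<and>
     (\<forall>X Y. vector_field A X \<longrightarrow> vector_field A Y \<longrightarrow> g X Y = g Y X) \<and>
     (\<forall>X p. vector_field A X \<longrightarrow> nonzero_at X p \<longrightarrow> g X X p > 0)"

definition affine_connection ::
    "('a, 'n::finite) chart set \<Rightarrow> ('a vfield \<Rightarrow> 'a vfield \<Rightarrow> 'a vfield) \<Rightarrow> bool" where
  "affine_connection A D \<longleftrightarrow>
     (\<forall>X Y. vector_field A X \<longrightarrow> vector_field A Y \<longrightarrow> vector_field A (D X Y)) \<and>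
     (\<forall>X Y Z. vector_field A X \<longrightarrow> vector_field A Y \<longrightarrow> vector_field A Z \<longrightarrow>
        D (vf_add X Y) Z = vf_add (D X Z) (D Y Z) \<and>
        D Z (vf_add X Y) = vf_add (D Z X) (D Z Y)) \<and>
     (\<forall>f X Y. smooth_fun A f \<longrightarrow> vector_field A X \<longrightarrow> vector_field A Y \<longrightarrow>
        D (vf_scale f X) Y = vf_scale f (D X Y) \<and>
        D X (vf_scale f Y) = vf_add (vf_scale (X f) Y) (vf_scale f (D X Y)))"

definition levi_civita_connection ::
    "('a, 'n::finite) chart set \<Rightarrow> 'a tensor2 \<Rightarrow> ('a vfield \<Rightarrow> 'a vfield \<Rightarrow> 'a vfield) \<Rightarrow> bool" where
  "levi_civita_connection A g D \<longleftrightarrow>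
     affine_connection A D \<and>
     (\<forall>X Y. vector_field A X \<longrightarrow> vector_field A Y \<longrightarrow>
        vf_diff (D X Y) (D Y X) = lie_bracket X Y) \<and>
     (\<forall>X Y Z. vector_field A X \<longrightarrow> vector_field A Y \<longrightarrow> vector_field A Z \<longrightarrow>
        X (g Y Z) = (\<lambda>p. g (D X Y) Z p + g Y (D X Z) p))"

definition curvature ::
    "('a vfield \<Rightarrow> 'a vfield \<Rightarrow> 'a vfield) \<Rightarrow> 'a vfield \<Rightarrow> 'a vfield \<Rightarrow> 'a vfield \<Rightarrow> 'a vfield" where
  "curvature D X Y Z =
     vf_diff (vf_diff (D X (D Y Z)) (D Y (D X Z))) (D (lie_bracket X Y) Z)"

definition riemann_tensor ::
    "'a tensor2 \<Rightarrow> ('a vfield \<Rightarrow> 'a vfield \<Rightarrow> 'a vfield) \<Rightarrow> 'a tensor4" where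
  "riemann_tensor g D X Y Z W = g (curvature D X Y Z) W"

definition kulkarni_nomizu :: "'a tensor2 \<Rightarrow> 'a tensor2 \<Rightarrow> 'a tensor4" where
  "kulkarni_nomizu S T X Y Z W = (\<lambda>p.
     S X W p * T Y Z p + S Y Z p * T X W p - S X Z p * T Y W p - S Y W p * T X Z p)"

definition lie_derivative2 :: "'a vfield \<Rightarrow> 'a tensor2 \<Rightarrow> 'a tensor2" where
  "lie_derivative2 V T X Y = (\<lambda>p.
     V (T X Y) p - T (lie_bracket V X) Y p - T X (lie_bracket V Y) p)"


section \<open>Differential operators\<close>

definition grad :: "('a, 'n::finite) chart set \<Rightarrow> 'a tensor2 \<Rightarrow> ('a \<Rightarrow> real) \<Rightarrow> 'a vfield" where
  "grad A g f = (THE V. vector_field A V \<and> (\<forall>X. vector_field A X \<longrightarrow> g V X = X f))"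

text \<open>A local orthonormal frame near \<open>p\<close> is given by global vector fields that are orthonormal on
  some neighbourhood of \<open>p\<close>; a frame defined only near \<open>p\<close> agrees with such a family on a smaller
  neighbourhood (multiply by a cut-off function).\<close>

definition local_orthonormal_frame ::
    "('a::topological_space, 'n::finite) chart set \<Rightarrow> 'a tensor2 \<Rightarrow> 'a \<Rightarrow> ('n \<Rightarrow> 'a vfield) \<Rightarrow> bool" where
  "local_orthonormal_frame A g p E \<longleftrightarrow>
     (\<forall>i. vector_field A (E i)) \<and>
     (\<exists>U. open U \<and> p \<in> U \<and> (\<forall>q\<in>U. \<forall>i j. g (E i) (E j) q = (if i = j then 1 else 0)))"

text \<open>The two sums below do not depend on the local orthonormal frame. The divergence is the trace
  of \<open>X \<mapsto> \<nabla>\<^sub>X V\<close>.\<close>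

definition divergence ::
    "('a::topological_space, 'n::finite) chart set \<Rightarrow> 'a tensor2 \<Rightarrow>
     ('a vfield \<Rightarrow> 'a vfield \<Rightarrow> 'a vfield) \<Rightarrow> 'a vfield \<Rightarrow> 'a \<Rightarrow> real" where
  "divergence A g D V = (\<lambda>p.
     let E = (SOME E. local_orthonormal_frame A g p E) in \<Sum>i\<in>UNIV. g (D (E i) V) (E i) p)"

definition norm_nabla_sq ::
    "('a::topological_space, 'n::finite) chart set \<Rightarrow> 'a tensor2 \<Rightarrow>
     ('a vfield \<Rightarrow> 'a vfield \<Rightarrow> 'a vfield) \<Rightarrow> 'a vfield \<Rightarrow> 'a \<Rightarrow> real" where
  "norm_nabla_sq A g D V = (\<lambda>p.
     let E = (SOME E. local_orthonormal_frame A g p E) in \<Sum>i\<in>UNIV. g (D (E i) V) (D (E i) V) p)"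

definition laplacian ::
    "('a::topological_space, 'n::finite) chart set \<Rightarrow> 'a tensor2 \<Rightarrow>
     ('a vfield \<Rightarrow> 'a vfield \<Rightarrow> 'a vfield) \<Rightarrow> ('a \<Rightarrow> real) \<Rightarrow> 'a \<Rightarrow> real" where
  "laplacian A g D f = divergence A g D (grad A g f)"


section \<open>Almost Riemann solitons\<close>

definition almost_riemann_soliton ::
    "('a, 'n::finite) chart set \<Rightarrow> 'a tensor2 \<Rightarrow> ('a vfield \<Rightarrow> 'a vfield \<Rightarrow> 'a vfield) \<Rightarrow>
     'a vfield \<Rightarrow> ('a \<Rightarrow> real) \<Rightarrow> bool" where
  "almost_riemann_soliton A g D V lam \<longleftrightarrow>
     vector_field A V \<and> (\<forall>p. nonzero_at V p) \<and> smooth_fun A lam \<and>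
     (\<forall>X Y Z W. vector_field A X \<longrightarrow> vector_field A Y \<longrightarrow> vector_field A Z \<longrightarrow> vector_field A W \<longrightarrow>
        (\<forall>p. 1/2 * kulkarni_nomizu (lie_derivative2 V g) g X Y Z W p + riemann_tensor g D X Y Z W p
           = lam p * (1/2 * kulkarni_nomizu g g X Y Z W p)))"

definition gradient_almost_riemann_soliton ::
    "('a, 'n::finite) chart set \<Rightarrow> 'a tensor2 \<Rightarrow> ('a vfield \<Rightarrow> 'a vfield \<Rightarrow> 'a vfield) \<Rightarrow>
     'a vfield \<Rightarrow> ('a \<Rightarrow> real) \<Rightarrow> bool" where
  "gradient_almost_riemann_soliton A g D V lam \<longleftrightarrow>
     almost_riemann_soliton A g D V lam \<and> (\<exists>f. smooth_fun A f \<and> V = grad A g f)"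

end

theory Submission
  imports Defs
begin

text \<open>Evaluating the soliton equation at \<open>(E\<^sub>i, V, V, E\<^sub>i)\<close> and summing over an orthonormal frame expresses
  \<open>(n - 1) \<lambda> |V|\<^sup>2\<close> through \<open>Ric(V, V)\<close>, \<open>div V\<close> and \<open>V(|V|\<^sup>2)\<close>. The Ricci term is eliminated by the
  Bochner formula \<open>1/2 \<Delta>|V|\<^sup>2 = |\<nabla>V|\<^sup>2 + V(div V) + Ric(V, V)\<close>, valid for gradient fields, which rests on the
  symmetry of the Hessian; in particular \<open>grad |V|\<^sup>2 = 2 \<nabla>\<^sub>V V\<close>. Since vector fields are derivations,
  the pointwise linear algebra needs Hadamard's lemma: near a point every derivation is
  a smooth combination of \<open>n\<close> coordinate fields.\<close>

section \<open>Differentiable functions of class \<open>C\<^sup>k\<close>\<close>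

text \<open>Two features of the definitions shape the work. A vector field is a derivation of global
  functions, so neither its value at a point nor its restriction to an open set is part of the data:
  every local construction has to be cut off by bump functions, and dependence on the value at a
  point alone has to be derived (\<open>tensorial_at_vanish\<close>). Moreover,
  \<open>divergence\<close> and \<open>norm_nabla_sq\<close> choose an arbitrary frame separately at
  each point, with no continuity in the point; frame independence has to come before
  \<open>divergence A g D V\<close> can be differentiated. The Bochner computation uses a frame that
  is merely orthonormal near the point, not one that is parallel there. The leftover terms pair the
  symmetric Hessian with the matrix of \<open>D V\<close> in the frame, which is skew because the
  inner products of the frame are locally constant, so their sum vanishes.\<close>

lemma Ck_on_SucI:
  assumes "\<And>x. x \<in> S \<Longrightarrow> (f has_derivative f' x) (at x)"
    and "\<And>v. Ck_on k S (\<lambda>x. f' x v)" and "open S"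
  shows "Ck_on (Suc k) S f"
proof -
  have *: "frechet_derivative f (at x) = f' x" if "x \<in> S" for x
    using frechet_derivative_at[OF assms(1)[OF that]] by simp
  \<comment> \<open>Locality is proved inside this lemma because the general form,
    \<open>Ck_on_cong\<close>, is itself derived from the present rule. Openness of \<open>S\<close>
    is what lets equality on \<open>S\<close> transfer derivatives.\<close>
  have cong: "Ck_on k S h" if "\<And>x. x \<in> S \<Longrightarrow> h x = h' x" "Ck_on k S h'" for h h' :: "'a \<Rightarrow> 'b"
    using that
  proof (induction k arbitrary: h h')
    case 0
    then show ?case by (simp cong: continuous_on_cong)
  next
    case (Suc k)
    have d: "h differentiable (at x)" "frechet_derivative h (at x) = frechet_derivative h' (at x)" if "x \<in> S" for x
    proof -
      have "h' differentiable (at x)" using Suc.prems that by simp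
      then have "(h' has_derivative frechet_derivative h' (at x)) (at x)"
        by (simp add: frechet_derivative_works)
      then have h: "(h has_derivative frechet_derivative h' (at x)) (at x)"
        by (rule has_derivative_transform_within_open[OF _ \<open>open S\<close> that]) (simp add: Suc.prems)
      then show "h differentiable (at x)" by (auto simp: differentiable_def)
      show "frechet_derivative h (at x) = frechet_derivative h' (at x)"
        using frechet_derivative_at[OF h] by simp
    qed
    show ?case using d Suc.IH[of "\<lambda>x. frechet_derivative h (at x) v" "\<lambda>x. frechet_derivative h' (at x) v" for v] Suc.prems(2)
      by simp
  qed
  show ?thesis
    using assms(1,2) cong[of "\<lambda>x. frechet_derivative f (at x) v" "\<lambda>x. f' x v" for v]
    by (auto simp: * differentiable_def)
qed

lemma Ck_on_SucD:
  assumes "Ck_on (Suc k) S f"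
  shows "x \<in> S \<Longrightarrow> (f has_derivative frechet_derivative f (at x)) (at x)"
    and "Ck_on k S (\<lambda>x. frechet_derivative f (at x) v)"
  using assms by (auto simp: frechet_derivative_works)

lemma Ck_on_SucD_differentiable: "Ck_on (Suc k) S f \<Longrightarrow> x \<in> S \<Longrightarrow> f differentiable (at x)"
  by simp

declare Ck_on.simps(2) [simp del]

lemma Ck_on_cong:
  assumes "open S" "\<And>x. x \<in> S \<Longrightarrow> f x = g x" "Ck_on k S f"
  shows "Ck_on k S g"
proof (cases k)
  case 0
  then show ?thesis using assms by (simp cong: continuous_on_cong)
next
  case (Suc j)
  show ?thesis unfolding Suc
  proof (rule Ck_on_SucI)
    show "(g has_derivative frechet_derivative f (at x)) (at x)" if "x \<in> S" for x
      using Ck_on_SucD(1)[OF assms(3)[unfolded Suc] that] assms(1) that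
      by (rule has_derivative_transform_within_open) (simp add: assms(2))
  qed (use assms(1) Ck_on_SucD(2)[OF assms(3)[unfolded Suc]] in simp_all)
qed

lemma Ck_on_lower: "Ck_on (Suc k) S f \<Longrightarrow> Ck_on k S f"
proof (induction k arbitrary: f)
  case 0
  show ?case
    using has_derivative_continuous[OF Ck_on_SucD(1)[OF 0]] by (simp add: continuous_at_imp_continuous_on)
next
  case (Suc k)
  have "Ck_on k S (\<lambda>x. frechet_derivative f (at x) v)" for v
    by (rule Suc.IH[OF Ck_on_SucD(2)[OF Suc.prems]])
  with Suc.prems show ?case by (simp add: Ck_on.simps(2)[of k] Ck_on_SucD_differentiable)
qed

lemma Ck_on_le:
  assumes "j \<le> k" "Ck_on k S f"
  shows "Ck_on j S f"
  using assms(1)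
proof (induction rule: inc_induct)
  case base
  show ?case by (rule assms(2))
next
  case (step n)
  show ?case by (rule Ck_on_lower[OF step.IH])
qed

lemma Ck_on_subset:
  assumes "T \<subseteq> S"
  shows "Ck_on k S f \<Longrightarrow> Ck_on k T f"
proof (induction k arbitrary: f)
  case 0
  then show ?case using assms by (simp add: continuous_on_subset)
next
  case (Suc k)
  then show ?case using assms by (simp add: Ck_on.simps(2) subset_iff)
qed

lemma Ck_on_local:
  assumes "\<And>x. x \<in> S \<Longrightarrow> \<exists>T. open T \<and> x \<in> T \<and> Ck_on k T f"
  shows "Ck_on k S f"
  using assms
proof (induction k arbitrary: f)
  case 0
  show ?case unfolding Ck_on.simps
  proof (rule continuous_at_imp_continuous_on, rule ballI)
    fix x assume "x \<in> S"
    from 0[OF this] obtain T where "open T" "x \<in> T" "continuous_on T f" by auto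
    then show "isCont f x" by (simp add: continuous_on_eq_continuous_at)
  qed
next
  case (Suc k)
  have "Ck_on k S (\<lambda>x. frechet_derivative f (at x) v)" for v
  proof (rule Suc.IH)
    fix x assume "x \<in> S"
    from Suc.prems[OF this] obtain T where "open T" "x \<in> T" "Ck_on (Suc k) T f" by auto
    then show "\<exists>T. open T \<and> x \<in> T \<and> Ck_on k T (\<lambda>x. frechet_derivative f (at x) v)"
      by (intro exI[of _ T] conjI Ck_on_SucD(2))
  qed
  moreover have "f differentiable (at x)" if "x \<in> S" for x
  proof -
    from Suc.prems[OF that] obtain T where "x \<in> T" "Ck_on (Suc k) T f" by auto
    then show ?thesis by (simp add: Ck_on_SucD_differentiable)
  qed
  ultimately show ?case by (simp add: Ck_on.simps(2))
qed

lemma Ck_on_const: "open S \<Longrightarrow> Ck_on k S (\<lambda>x. c)"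
proof (induction k arbitrary: c)
  case (Suc k)
  show ?case by (rule Ck_on_SucI[where f' = "\<lambda>x v. 0", OF _ Suc.IH[OF Suc.prems] Suc.prems]) simp
qed simp

lemma Ck_on_bounded_linear_comp:
  assumes "bounded_linear L" "open S"
  shows "Ck_on k S f \<Longrightarrow> Ck_on k S (\<lambda>x. L (f x))"
proof (induction k arbitrary: f)
  case 0
  then show ?case
    using bounded_linear.continuous_on[OF assms(1)] by simp
next
  case (Suc k)
  show ?case
    by (rule Ck_on_SucI[where f' = "\<lambda>x v. L (frechet_derivative f (at x) v)"])
      (auto intro!: bounded_linear.has_derivative[OF assms(1)] Suc.IH assms(2)
        Ck_on_SucD[OF Suc.prems])
qed

lemma Ck_on_id: "open S \<Longrightarrow> Ck_on k S (\<lambda>x. x)"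
proof (cases k)
  case (Suc j)
  assume "open S"
  then show ?thesis unfolding Suc
    by (intro Ck_on_SucI[where f' = "\<lambda>x v. v"]) (auto intro: Ck_on_const)
qed simp

lemma Ck_on_add:
  assumes "open S"
  shows "Ck_on k S f \<Longrightarrow> Ck_on k S g \<Longrightarrow> Ck_on k S (\<lambda>x. f x + g x)"
proof (induction k arbitrary: f g)
  case 0
  then show ?case by (auto intro: continuous_on_add)
next
  case (Suc k)
  show ?case
    by (rule Ck_on_SucI[where f' = "\<lambda>x v. frechet_derivative f (at x) v + frechet_derivative g (at x) v"])
      (auto intro!: has_derivative_add Suc.IH assms
        Ck_on_SucD[OF Suc.prems(1)] Ck_on_SucD[OF Suc.prems(2)])
qed

lemma Ck_on_sum:
  assumes "open S" "finite I" "\<And>i. i \<in> I \<Longrightarrow> Ck_on k S (f i)"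
  shows "Ck_on k S (\<lambda>x. \<Sum>i\<in>I. f i x)"
  using assms(2,3) by (induction I) (auto intro: Ck_on_const Ck_on_add assms(1))

lemma Ck_on_mult:
  fixes f g :: "'b::real_normed_vector \<Rightarrow> real"
  assumes "open S"
  shows "Ck_on k S f \<Longrightarrow> Ck_on k S g \<Longrightarrow> Ck_on k S (\<lambda>x. f x * g x)"
proof (induction k arbitrary: f g)
  case 0
  then show ?case by (auto intro: continuous_on_mult)
next
  case (Suc k)
  show ?case
  proof (rule Ck_on_SucI[OF _ _ assms])
    show "((\<lambda>x. f x * g x) has_derivative
        (\<lambda>v. f x * frechet_derivative g (at x) v + frechet_derivative f (at x) v * g x)) (at x)" if "x \<in> S" for x
      using Ck_on_SucD(1)[OF Suc.prems(1) that] Ck_on_SucD(1)[OF Suc.prems(2) that] by (rule has_derivative_mult)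
    show "Ck_on k S (\<lambda>x. f x * frechet_derivative g (at x) v + frechet_derivative f (at x) v * g x)" for v
      by (intro Ck_on_add Suc.IH assms Ck_on_SucD(2)[OF Suc.prems(1)] Ck_on_SucD(2)[OF Suc.prems(2)]
        Ck_on_lower[OF Suc.prems(1)] Ck_on_lower[OF Suc.prems(2)])
  qed
qed

text \<open>In the chain rule the outer derivative is taken in a direction that varies with the
  point, whereas \<open>Ck_on\<close> speaks of fixed directions. Expanding the direction over
  \<open>Basis\<close> turns the derivative into a sum of products of real functions, to which the
  induction hypothesis and \<open>Ck_on_mult\<close> apply.\<close>

lemma Ck_on_compose:
  fixes f :: "'c::euclidean_space \<Rightarrow> real" and \<phi> :: "'b::real_normed_vector \<Rightarrow> 'c"
  assumes "open S" "open T" "\<phi> ` S \<subseteq> T"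
  shows "Ck_on k T f \<Longrightarrow> Ck_on k S \<phi> \<Longrightarrow> Ck_on k S (\<lambda>x. f (\<phi> x))"
proof (induction k arbitrary: f)
  case 0
  then show ?case using assms by (auto intro: continuous_on_compose2)
next
  case (Suc k)
  let ?f' = "\<lambda>y. frechet_derivative f (at y)" and ?p' = "\<lambda>x. frechet_derivative \<phi> (at x)"
  show ?case
  proof (rule Ck_on_SucI[OF _ _ assms(1)])
    fix x assume x: "x \<in> S"
    have f: "(f has_derivative ?f' (\<phi> x)) (at (\<phi> x))"
      using Ck_on_SucD(1)[OF Suc.prems(1)] x assms(3) by auto
    have p: "(\<phi> has_derivative ?p' x) (at x)"
      using Ck_on_SucD(1)[OF Suc.prems(2)] x by auto
    have fp: "((\<lambda>x. f (\<phi> x)) has_derivative (\<lambda>v. ?f' (\<phi> x) (?p' x v))) (at x)"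
      using has_derivative_compose[OF p f] .
    have rep: "?f' (\<phi> x) w = (\<Sum>b\<in>Basis. (w \<bullet> b) * ?f' (\<phi> x) b)" for w
    proof -
      have "?f' (\<phi> x) w = ?f' (\<phi> x) (\<Sum>b\<in>Basis. (w \<bullet> b) *\<^sub>R b)"
        by (simp add: euclidean_representation)
      also have "\<dots> = (\<Sum>b\<in>Basis. (w \<bullet> b) *\<^sub>R ?f' (\<phi> x) b)"
        using has_derivative_linear[OF f] by (simp add: linear_sum linear_scale)
      finally show ?thesis by simp
    qed
    show "((\<lambda>x. f (\<phi> x)) has_derivative (\<lambda>v. \<Sum>b\<in>Basis. (?p' x v \<bullet> b) * ?f' (\<phi> x) b)) (at x)"
      by (rule has_derivative_eq_rhs[OF fp ext]) (rule rep)
  next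
    fix v
    show "Ck_on k S (\<lambda>x. \<Sum>b\<in>Basis. (?p' x v \<bullet> b) * ?f' (\<phi> x) b)"
      by (intro Ck_on_sum Ck_on_mult assms(1) finite_Basis
          Ck_on_bounded_linear_comp[OF bounded_linear_inner_left]
          Suc.IH Ck_on_SucD(2)[OF Suc.prems(1)] Ck_on_SucD(2)[OF Suc.prems(2)]
          Ck_on_lower[OF Suc.prems(2)])
  qed
qed

text \<open>Serves both as division (exponent -1, in the bump function) and as inverse square root
  (exponent -1/2, in Gram-Schmidt). The exponent is generalised in the induction because
  differentiation lowers it by one.\<close>

lemma Ck_on_powr:
  fixes u :: "'b::real_normed_vector \<Rightarrow> real"
  assumes "open S" "\<And>x. x \<in> S \<Longrightarrow> u x > 0"
  shows "Ck_on k S u \<Longrightarrow> Ck_on k S (\<lambda>x. u x powr a)"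
proof (induction k arbitrary: a)
  case 0
  then show ?case using assms(2) by (auto intro!: continuous_intros) (metis less_irrefl)
next
  case (Suc k)
  show ?case
  proof (rule Ck_on_SucI[where f' = "\<lambda>x v. a * u x powr (a - 1) * frechet_derivative u (at x) v"])
    fix x assume x: "x \<in> S"
    have u: "(u has_derivative frechet_derivative u (at x)) (at x)"
      using Ck_on_SucD(1)[OF Suc.prems] x by auto
    have "((\<lambda>t. t powr a) has_derivative (\<lambda>s. a * u x powr (a - 1) * s)) (at (u x))"
      using has_real_derivative_powr[OF assms(2)[OF x], of a] by (simp add: has_field_derivative_def)
    from has_derivative_compose[OF u this]
    show "((\<lambda>x. u x powr a) has_derivative (\<lambda>v. a * u x powr (a - 1) * frechet_derivative u (at x) v)) (at x)" .
  qed (intro Ck_on_mult Ck_on_const assms(1) Suc.IH Ck_on_lower[OF Suc.prems] Ck_on_SucD(2)[OF Suc.prems])+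
qed

text \<open>The weight \<open>t ^ m\<close> makes the family stable under differentiation, which raises \<open>m\<close> by one.\<close>

lemma Ck_on_segment_integral:
  fixes F :: "'b::euclidean_space \<Rightarrow> real"
  assumes S: "open S" "convex S" "a \<in> S"
  shows "Ck_on (Suc k) S F \<Longrightarrow> Ck_on k S (\<lambda>x. integral {0..1} (\<lambda>t. t ^ m * F (a + t *\<^sub>R (x - a))))"
proof -
  have seg: "a + t *\<^sub>R (x - a) \<in> S" if "x \<in> S" "t \<in> {0..1}" for x t
    using convexD_alt[OF S(2,3) that(1), of t] that(2) by (simp add: algebra_simps)
  have der: "((\<lambda>x. integral {0..1} (\<lambda>t. t ^ m * F (a + t *\<^sub>R (x - a)))) has_derivative
      (\<lambda>v. integral {0..1} (\<lambda>t. t ^ Suc m * frechet_derivative F (at (a + t *\<^sub>R (x - a))) v))) (at x)"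
    if F: "Ck_on (Suc 0) S F" and x: "x \<in> S" for F :: "'b \<Rightarrow> real" and m x
  proof -
    \<comment> \<open>The Leibniz rule for parameter integrals asks for a derivative depending
      continuously on the point as a bounded linear map. In finite dimension this reduces to
      continuity of each directional derivative along a basis vector.\<close>
    define F' where "F' y = Blinfun (frechet_derivative F (at y))" for y
    have F': "blinfun_apply (F' y) = frechet_derivative F (at y)"
      and Fd: "(F has_derivative blinfun_apply (F' y)) (at y)" if "y \<in> S" for y
      using Ck_on_SucD(1)[OF F that] unfolding F'_def
      by (auto simp: bounded_linear_Blinfun_apply has_derivative_bounded_linear)
    have cF: "continuous_on S F" using Ck_on_lower[OF F] by simp
    have cF': "continuous_on S F'"
    proof (rule continuous_on_blinfun_componentwise)
      fix i :: 'b
      have "continuous_on S (\<lambda>y. frechet_derivative F (at y) i)"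
        using Ck_on_SucD(2)[OF F] by simp
      then show "continuous_on S (\<lambda>y. blinfun_apply (F' y) i)"
        by (simp add: F' cong: continuous_on_cong)
    qed
    let ?fx = "\<lambda>x t. (t ^ Suc m) *\<^sub>R F' (a + t *\<^sub>R (x - a))"
    have cfx: "continuous_on (S \<times> cbox 0 1) (\<lambda>(x, t). ?fx x t)"
      unfolding split_beta
      by (intro continuous_intros continuous_on_compose2[OF cF']) (auto simp: seg)
    have "((\<lambda>x. integral (cbox 0 1) (\<lambda>t. t ^ m * F (a + t *\<^sub>R (x - a)))) has_derivative
        blinfun_apply (integral (cbox 0 1) (?fx x))) (at x within S)"
    proof (rule leibniz_rule[OF _ _ cfx x S(2)])
      fix y t assume y: "y \<in> S" and t: "t \<in> cbox 0 (1::real)"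
      have "((\<lambda>x. a + t *\<^sub>R (x - a)) has_derivative (\<lambda>v. t *\<^sub>R v)) (at y within S)"
        by (auto intro!: derivative_eq_intros)
      from has_derivative_compose[OF this Fd[OF seg[OF y]]] t
      have "((\<lambda>x. F (a + t *\<^sub>R (x - a))) has_derivative (\<lambda>v. F' (a + t *\<^sub>R (y - a)) (t *\<^sub>R v))) (at y within S)"
        by simp
      from has_derivative_mult_right[OF this, of "t ^ m"]
      show "((\<lambda>x. t ^ m * F (a + t *\<^sub>R (x - a))) has_derivative blinfun_apply (?fx y t)) (at y within S)"
        by (rule has_derivative_eq_rhs) (auto simp: blinfun.scaleR_left blinfun.scaleR_right)
    next
      fix y assume y: "y \<in> S"
      show "(\<lambda>t. t ^ m * F (a + t *\<^sub>R (y - a))) integrable_on cbox 0 1"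
        by (intro integrable_continuous continuous_intros continuous_on_compose2[OF cF])
          (auto simp: seg y)
    qed
    moreover have "blinfun_apply (integral (cbox 0 1) (?fx x)) =
        (\<lambda>v. integral (cbox 0 1) (\<lambda>t. t ^ Suc m * frechet_derivative F (at (a + t *\<^sub>R (x - a))) v))"
    proof
      fix v
      have "?fx x integrable_on cbox 0 1"
        by (intro integrable_continuous continuous_intros continuous_on_compose2[OF cF'])
          (auto simp: seg x)
      then have "blinfun_apply (integral (cbox 0 1) (?fx x)) v = integral (cbox 0 1) (\<lambda>t. blinfun_apply (?fx x t) v)"
        by (rule blinfun_apply_integral)
      also have "\<dots> = integral (cbox 0 1) (\<lambda>t. t ^ Suc m * frechet_derivative F (at (a + t *\<^sub>R (x - a))) v)"
        by (rule Henstock_Kurzweil_Integration.integral_cong)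
          (use F' seg x in \<open>auto simp: blinfun.scaleR_left\<close>)
      finally show "blinfun_apply (integral (cbox 0 1) (?fx x)) v = \<dots>" .
    qed
    ultimately show ?thesis
      unfolding at_within_open[OF x S(1)] cbox_interval by (simp only:)
  qed
  show "Ck_on (Suc k) S F \<Longrightarrow> Ck_on k S (\<lambda>x. integral {0..1} (\<lambda>t. t ^ m * F (a + t *\<^sub>R (x - a))))"
  proof (induction k arbitrary: F m)
    case 0
    show ?case unfolding Ck_on.simps
      using der[OF 0] by (auto intro!: continuous_at_imp_continuous_on has_derivative_continuous)
  next
    case (Suc k)
    have 1: "Ck_on (Suc 0) S F"
      by (rule Ck_on_le[OF _ Suc.prems]) simp
    show ?case
      by (rule Ck_on_SucI[OF der[OF 1] Suc.IH[OF Ck_on_SucD(2)[OF Suc.prems]] S(1)])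
  qed
qed

section \<open>Closure properties of smooth maps on open sets\<close>

lemma smooth_onI: "(\<And>k. Ck_on k S f) \<Longrightarrow> smooth_on S f"
  and smooth_onD: "smooth_on S f \<Longrightarrow> Ck_on k S f"
  by (auto simp: smooth_on_def)

lemma smooth_on_cong: "open S \<Longrightarrow> (\<And>x. x \<in> S \<Longrightarrow> f x = g x) \<Longrightarrow> smooth_on S f \<Longrightarrow> smooth_on S g"
  unfolding smooth_on_def using Ck_on_cong by blast

lemma smooth_on_subset: "smooth_on S f \<Longrightarrow> T \<subseteq> S \<Longrightarrow> smooth_on T f"
  unfolding smooth_on_def using Ck_on_subset by blast

lemma smooth_on_local:
  assumes "\<And>x. x \<in> S \<Longrightarrow> \<exists>T. open T \<and> x \<in> T \<and> smooth_on T f"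
  shows "smooth_on S f"
  unfolding smooth_on_def using Ck_on_local[of S _ f] assms smooth_on_def by metis

lemma smooth_on_const: "open S \<Longrightarrow> smooth_on S (\<lambda>x. c)"
  by (simp add: smooth_on_def Ck_on_const)

lemma smooth_on_bounded_linear_comp:
  "bounded_linear L \<Longrightarrow> open S \<Longrightarrow> smooth_on S f \<Longrightarrow> smooth_on S (\<lambda>x. L (f x))"
  by (simp add: smooth_on_def Ck_on_bounded_linear_comp)

lemma smooth_on_bounded_linear: "bounded_linear L \<Longrightarrow> open S \<Longrightarrow> smooth_on S L"
  using smooth_on_bounded_linear_comp[of L S "\<lambda>x. x"] by (simp add: smooth_on_def Ck_on_id)

lemma smooth_on_add:
  "open S \<Longrightarrow> smooth_on S f \<Longrightarrow> smooth_on S g \<Longrightarrow> smooth_on S (\<lambda>x. f x + g x)"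
  by (simp add: smooth_on_def Ck_on_add)

lemma smooth_on_sum:
  "open S \<Longrightarrow> finite I \<Longrightarrow> (\<And>i. i \<in> I \<Longrightarrow> smooth_on S (f i)) \<Longrightarrow> smooth_on S (\<lambda>x. \<Sum>i\<in>I. f i x)"
  by (simp add: smooth_on_def Ck_on_sum)

lemma smooth_on_mult:
  fixes f g :: "'b::real_normed_vector \<Rightarrow> real"
  shows "open S \<Longrightarrow> smooth_on S f \<Longrightarrow> smooth_on S g \<Longrightarrow> smooth_on S (\<lambda>x. f x * g x)"
  by (simp add: smooth_on_def Ck_on_mult)

lemma smooth_on_compose:
  fixes f :: "'c::euclidean_space \<Rightarrow> real" and \<phi> :: "'b::real_normed_vector \<Rightarrow> 'c"
  assumes "open S" "open T" "\<phi> ` S \<subseteq> T" "smooth_on T f" "smooth_on S \<phi>"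
  shows "smooth_on S (\<lambda>x. f (\<phi> x))"
  by (rule smooth_onI) (rule Ck_on_compose[OF assms(1-3) smooth_onD smooth_onD, OF assms(4,5)])

lemma smooth_on_powr:
  fixes u :: "'b::real_normed_vector \<Rightarrow> real"
  shows "open S \<Longrightarrow> (\<And>x. x \<in> S \<Longrightarrow> u x > 0) \<Longrightarrow> smooth_on S u \<Longrightarrow> smooth_on S (\<lambda>x. u x powr a)"
  by (simp add: smooth_on_def Ck_on_powr)

lemma smooth_on_has_derivative:
  "smooth_on S f \<Longrightarrow> x \<in> S \<Longrightarrow> (f has_derivative frechet_derivative f (at x)) (at x)"
  by (rule Ck_on_SucD(1)[OF smooth_onD])

lemma smooth_on_frechet_derivative:
  "smooth_on S f \<Longrightarrow> smooth_on S (\<lambda>x. frechet_derivative f (at x) v)"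
  by (rule smooth_onI) (rule Ck_on_SucD(2)[OF smooth_onD])

text \<open>The fundamental theorem of calculus along the segment from \<open>a\<close> to
  \<open>x\<close>, which convexity keeps inside \<open>S\<close>: the coefficient
  \<open>h b\<close> is the average over the segment of the partial derivative in direction
  \<open>b\<close>. At \<open>x = a\<close> the integrand is constant, whence the value of
  \<open>h b a\<close>.\<close>

lemma hadamard:
  fixes f :: "'b::euclidean_space \<Rightarrow> real"
  assumes S: "open S" "convex S" "a \<in> S" and f: "smooth_on S f"
  obtains h where "\<And>b. smooth_on S (h b)" "\<And>b. h b a = frechet_derivative f (at a) b"
    "\<And>x. x \<in> S \<Longrightarrow> f x = f a + (\<Sum>b\<in>Basis. ((x - a) \<bullet> b) * h b x)"
proof
  \<comment> \<open>The factor \<open>t ^ 0\<close> exhibits this as the case \<open>m = 0\<close>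
    of \<open>Ck_on_segment_integral\<close>.\<close>
  define h where "h b x = integral {0..1} (\<lambda>t. t ^ 0 * frechet_derivative f (at (a + t *\<^sub>R (x - a))) b)" for b x
  show "smooth_on S (h b)" for b
    unfolding h_def
    by (intro smooth_onI Ck_on_segment_integral S) (rule smooth_onD[OF smooth_on_frechet_derivative[OF f]])
  show "h b a = frechet_derivative f (at a) b" for b
    by (simp add: h_def)
  fix x assume x: "x \<in> S"
  have seg: "a + t *\<^sub>R (x - a) \<in> S" if "t \<in> {0..1}" for t
    using convexD_alt[OF S(2,3) x, of t] that by (simp add: algebra_simps)
  let ?F = "\<lambda>t. frechet_derivative f (at (a + t *\<^sub>R (x - a)))"
  have lin: "?F t (x - a) = (\<Sum>b\<in>Basis. ((x - a) \<bullet> b) * ?F t b)" if "t \<in> {0..1}" for t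
  proof -
    have "linear (?F t)"
      using smooth_on_has_derivative[OF f seg[OF that]] by (rule has_derivative_linear)
    then have "?F t (\<Sum>b\<in>Basis. ((x - a) \<bullet> b) *\<^sub>R b) = (\<Sum>b\<in>Basis. ((x - a) \<bullet> b) *\<^sub>R ?F t b)"
      by (simp add: linear_sum linear_scale)
    then show ?thesis by (simp add: euclidean_representation)
  qed
  have "((\<lambda>t. ?F t (x - a)) has_integral (f (a + 1 *\<^sub>R (x - a)) - f (a + 0 *\<^sub>R (x - a)))) {0..1}"
  proof (rule fundamental_theorem_of_calculus)
    fix t :: real assume t: "t \<in> {0..1}"
    have 1: "((\<lambda>t. a + t *\<^sub>R (x - a)) has_derivative (\<lambda>s. s *\<^sub>R (x - a))) (at t within {0..1})"
      by (auto intro!: derivative_eq_intros)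
    have d: "(f has_derivative ?F t) (at (a + t *\<^sub>R (x - a)))"
      by (rule smooth_on_has_derivative[OF f seg[OF t]])
    from has_derivative_compose[OF 1 d]
    show "((\<lambda>t. f (a + t *\<^sub>R (x - a))) has_vector_derivative ?F t (x - a)) (at t within {0..1})"
      using has_derivative_linear[OF d] by (simp add: has_vector_derivative_def linear_scale)
  qed simp
  then have "((\<lambda>t. ?F t (x - a)) has_integral (f x - f a)) {0..1}"
    by (simp add: algebra_simps)
  from has_integral_eq[OF lin this]
  have "((\<lambda>t. \<Sum>b\<in>Basis. ((x - a) \<bullet> b) * ?F t b) has_integral (f x - f a)) {0..1}" .
  moreover have "((\<lambda>t. \<Sum>b\<in>Basis. ((x - a) \<bullet> b) * ?F t b) has_integral (\<Sum>b\<in>Basis. ((x - a) \<bullet> b) * h b x)) {0..1}"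
  proof (intro has_integral_sum has_integral_mult_right)
    fix b :: 'b
    have c: "continuous_on S (\<lambda>y. frechet_derivative f (at y) b)"
      using smooth_onD[OF smooth_on_frechet_derivative[OF f], of 0] by simp
    have "continuous_on {0..1} (\<lambda>t. ?F t b)"
      by (rule continuous_on_compose2[OF c]) (auto intro!: continuous_intros simp: seg)
    then have "(\<lambda>t. ?F t b) integrable_on {0..1}"
      by (rule integrable_continuous_interval)
    then show "((\<lambda>t. ?F t b) has_integral h b x) {0..1}"
      by (simp add: h_def has_integral_integral)
  qed simp
  ultimately have "f x - f a = (\<Sum>b\<in>Basis. ((x - a) \<bullet> b) * h b x)"
    by (rule has_integral_unique)
  then show "f x = f a + (\<Sum>b\<in>Basis. ((x - a) \<bullet> b) * h b x)"
    by (simp only: algebra_simps)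
qed

section \<open>Bump functions on Euclidean space\<close>

text \<open>The classical flat function is the case \<open>m = 0\<close>. The denominators make the
  family closed, up to linear combinations, under differentiation, so that smoothness becomes an
  induction over all \<open>m\<close> at once.\<close>

definition flat_exp :: "nat \<Rightarrow> real \<Rightarrow> real" where
  "flat_exp m t = (if t > 0 then exp (- 1 / t) / t ^ m else 0)"

text \<open>A bound of second order forces the difference quotient at 0 to tend to 0.\<close>

lemma flat_exp_bound: "\<exists>C. \<forall>t. \<bar>flat_exp m t\<bar> \<le> C * t\<^sup>2"
proof (intro exI allI)
  fix t :: real
  define C :: real where "C = fact (m + 2)"
  have "C > 0" by (simp add: C_def)
  have "\<bar>flat_exp m t\<bar> \<le> C * t\<^sup>2"
  proof (cases "t > 0")
    case True
    \<comment> \<open>One term of the exponential series at \<open>1 / t\<close> suffices: order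
      \<open>m\<close> absorbs the denominator, and two further orders leave the square.\<close>
    have "(\<Sum>k\<in>{m + 2}. (1 / t) ^ k /\<^sub>R fact k) \<le> exp (1 / t)"
      unfolding exp_def by (rule sum_le_suminf[OF summable_exp_generic]) (use True in auto)
    then have "(1 / t) ^ (m + 2) / C \<le> exp (1 / t)"
      by (simp add: C_def divide_inverse mult.commute del: fact_Suc)
    then have "exp (- (1 / t)) \<le> C * t ^ (m + 2)"
      using True \<open>C > 0\<close> by (simp add: exp_minus field_simps)
    then have "exp (- 1 / t) / t ^ m \<le> C * t\<^sup>2"
      using True by (simp add: divide_le_eq power2_eq_square mult_ac)
    then show ?thesis using True by (simp add: flat_exp_def)
  qed (simp add: flat_exp_def \<open>C > 0\<close> less_imp_le)
  then show "\<bar>flat_exp m t\<bar> \<le> fact (m + 2) * t\<^sup>2" by (simp only: C_def)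
qed

text \<open>Only \<open>t = 0\<close> needs an argument: there the claimed derivative is 0, and the
  quadratic bound makes the difference quotient at most a multiple of
  \<open>\<bar>h\<bar>\<close>.\<close>

lemma flat_exp_derivative:
  "(flat_exp m has_real_derivative (flat_exp (m + 2) t - m * flat_exp (m + 1) t)) (at t)"
proof -
  consider "t > 0" | "t < 0" | "t = 0" by linarith
  then show ?thesis
  proof cases
    case 1
    have "((\<lambda>t. exp (- 1 / t) / t ^ m) has_real_derivative (flat_exp (m + 2) t - m * flat_exp (m + 1) t)) (at t)"
    proof (cases m)
      case 0
      then show ?thesis using 1
        by (auto intro!: derivative_eq_intros simp: flat_exp_def field_simps power2_eq_square)
    next
      case (Suc j)
      have p: "((\<lambda>t. t ^ Suc j) has_real_derivative real (Suc j) * t ^ j) (at t)"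
        using DERIV_pow[of "Suc j" t] by simp
      have q: "((\<lambda>t. exp (- 1 / t)) has_real_derivative exp (- 1 / t) / t\<^sup>2) (at t)"
        using 1 by (auto intro!: derivative_eq_intros simp: field_simps power2_eq_square)
      show ?thesis unfolding Suc
        by (rule DERIV_cong[OF DERIV_divide[OF q p]])
          (use 1 in \<open>auto simp: flat_exp_def field_simps power2_eq_square\<close>)
    qed
    then show ?thesis
      by (rule has_field_derivative_transform_within_open[where S = "{0<..}"])
        (use 1 in \<open>auto simp: flat_exp_def\<close>)
  next
    case 2
    have "((\<lambda>t. 0) has_real_derivative (flat_exp (m + 2) t - m * flat_exp (m + 1) t)) (at t)"
      using 2 by (simp add: flat_exp_def)
    then show ?thesis
      by (rule has_field_derivative_transform_within_open[where S = "{..<0}"])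
        (use 2 in \<open>auto simp: flat_exp_def\<close>)
  next
    case 3
    obtain C where C: "\<bar>flat_exp m t\<bar> \<le> C * t\<^sup>2" for t
      using flat_exp_bound by blast
    have "((\<lambda>h. flat_exp m h / h) \<longlongrightarrow> 0) (at 0)"
    proof (rule Lim_null_comparison)
      show "\<forall>\<^sub>F h in at 0. norm (flat_exp m h / h) \<le> C * \<bar>h\<bar>"
      proof (rule always_eventually, rule allI)
        fix h :: real
        show "norm (flat_exp m h / h) \<le> C * \<bar>h\<bar>"
          using C[of h] by (cases "h = 0") (auto simp: divide_le_eq power2_eq_square mult.assoc)
      qed
      show "((\<lambda>h. C * \<bar>h\<bar>) \<longlongrightarrow> 0) (at (0::real))"
        by (auto intro!: tendsto_eq_intros)
    qed
    then show ?thesis using 3 by (simp add: DERIV_def flat_exp_def)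
  qed
qed

lemma smooth_on_flat_exp: "smooth_on UNIV (flat_exp m)"
proof (rule smooth_onI)
  show "Ck_on k UNIV (flat_exp m)" for k
  proof (induction k arbitrary: m)
    case 0
    show ?case using DERIV_isCont[OF flat_exp_derivative] by (simp add: continuous_at_imp_continuous_on)
  next
    case (Suc k)
    show ?case
    proof (rule Ck_on_SucI)
      show "(flat_exp m has_derivative (\<lambda>v. (flat_exp (m + 2) t + (- m) * flat_exp (m + 1) t) * v)) (at t)" for t
        using flat_exp_derivative[of m t] by (simp add: has_field_derivative_def)
    qed (intro Ck_on_mult Ck_on_add Ck_on_const Suc.IH open_UNIV)+
  qed
qed

text \<open>The usual quotient u / (u + w) of two flat functions of the squared distance. The
  squared distance is used because, unlike the distance, it is smooth at the centre.\<close>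

lemma smooth_bump:
  fixes a :: "'b::euclidean_space"
  assumes "open T" "a \<in> T"
  obtains b :: "'b \<Rightarrow> real" and r where "r > 0" "cball a (2 * r) \<subseteq> T" "smooth_on UNIV b"
    "\<And>x. x \<in> ball a r \<Longrightarrow> b x = 1" "\<And>x. x \<notin> cball a (2 * r) \<Longrightarrow> b x = 0"
proof -
  from assms obtain e where e: "e > 0" "cball a e \<subseteq> T" using open_contains_cball by blast
  define r where "r = e / 2"
  have r: "r > 0" "cball a (2 * r) \<subseteq> T" using e by (auto simp: r_def)
  define s where "s x = (\<Sum>i\<in>Basis. ((x \<bullet> i) + (- (a \<bullet> i))) * ((x \<bullet> i) + (- (a \<bullet> i))))" for x
  have s: "s x = (dist a x)\<^sup>2" for x
    unfolding s_def dist_commute[of a]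
    by (subst euclidean_dist_l2) (simp add: L2_set_def sum_nonneg dist_real_def power2_eq_square)
  have ss: "smooth_on UNIV s"
    unfolding s_def
    by (intro smooth_on_sum smooth_on_mult smooth_on_add smooth_on_const open_UNIV finite_Basis
        smooth_on_bounded_linear[OF bounded_linear_inner_left])
  \<comment> \<open>\<open>u\<close> is positive exactly at distance less than \<open>2 * r\<close>
    from \<open>a\<close>, and \<open>w\<close> exactly at distance greater than \<open>r\<close>.
    Since r^2 < 4 r^2, at least one of them is positive everywhere, so the quotient \<open>b\<close>
    below has no zero in its denominator.\<close>
  define u where "u x = flat_exp 0 (4 * r\<^sup>2 + (- 1) * s x)" for x
  define w where "w x = flat_exp 0 (s x + (- (r\<^sup>2)))" for x
  have su: "smooth_on UNIV u"
    unfolding u_def by (rule smooth_on_compose[OF open_UNIV open_UNIV _ smooth_on_flat_exp])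
      (intro smooth_on_add smooth_on_mult smooth_on_const ss open_UNIV subset_UNIV)+
  have sw: "smooth_on UNIV w"
    unfolding w_def by (rule smooth_on_compose[OF open_UNIV open_UNIV _ smooth_on_flat_exp])
      (intro smooth_on_add smooth_on_mult smooth_on_const ss open_UNIV subset_UNIV)+
  have nn: "flat_exp 0 t \<ge> 0" "t > 0 \<Longrightarrow> flat_exp 0 t > 0" "t \<le> 0 \<Longrightarrow> flat_exp 0 t = 0" for t
    by (auto simp: flat_exp_def)
  have pos: "u x + w x > 0" for x
  proof -
    have "4 * r\<^sup>2 + (- 1) * s x > 0 \<or> s x + (- (r\<^sup>2)) > 0"
      using r(1) zero_less_power[OF r(1), of 2] by linarith
    then show ?thesis unfolding u_def w_def
      using nn by (meson add_nonneg_pos add_pos_nonneg)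
  qed
  define b where "b x = u x * (u x + w x) powr (- 1)" for x
  show thesis
  proof (rule that[OF r, of b])
    show "smooth_on UNIV b"
      unfolding b_def by (intro smooth_on_mult smooth_on_powr smooth_on_add su sw open_UNIV pos)
    show "b x = 1" if "x \<in> ball a r" for x
    proof -
      have "s x \<le> r\<^sup>2" using that unfolding s by (intro power_mono) auto
      then have "w x = 0" unfolding w_def by (intro nn(3)) simp
      then show ?thesis using pos[of x] by (simp add: b_def powr_minus)
    qed
    show "b x = 0" if "x \<notin> cball a (2 * r)" for x
    proof -
      have "(2 * r)\<^sup>2 \<le> s x" using that r(1) unfolding s by (intro power_mono) auto
      then have "u x = 0" unfolding u_def by (intro nn(3)) (simp add: power_mult_distrib)
      then show ?thesis by (simp add: b_def)
    qed
  qed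
qed

section \<open>Smooth functions and vector fields on a manifold\<close>

text \<open>Coordinates and powers of positive functions are smooth only on part of the manifold;
  this notion holds them until a cut-off makes them global.\<close>

definition smooth_in :: "('a, 'n::finite) chart set \<Rightarrow> 'a set \<Rightarrow> ('a \<Rightarrow> real) \<Rightarrow> bool" where
  "smooth_in A M f \<longleftrightarrow> (\<forall>(U, \<phi>)\<in>A. smooth_on (\<phi> ` (M \<inter> U)) (f \<circ> inv_into U \<phi>))"

lemma smooth_in_UNIV: "smooth_in A UNIV f \<longleftrightarrow> smooth_fun A f"
  by (simp add: smooth_in_def smooth_fun_def)

lemma smooth_in_subset: "smooth_in A M f \<Longrightarrow> N \<subseteq> M \<Longrightarrow> smooth_in A N f"
  unfolding smooth_in_def by (fast intro: smooth_on_subset)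

lemma smooth_fun_imp_smooth_in: "smooth_fun A f \<Longrightarrow> smooth_in A M f"
  using smooth_in_subset smooth_in_UNIV by blast

locale smooth_manifold =
  fixes A :: "('a::t2_space, 'n::finite) chart set"
  assumes atlas: "smooth_atlas A"
begin

lemma chart_at: obtains U \<phi> where "(U, \<phi>) \<in> A" "p \<in> U"
proof -
  have "p \<in> (\<Union>(U, \<phi>)\<in>A. U)" using atlas unfolding smooth_atlas_def by simp
  then show thesis using that by auto
qed

lemma
  assumes "(U, \<phi>) \<in> A"
  shows chart_open: "open U" and chart_image_open: "open (\<phi> ` U)"
    and chart_homeomorphism: "homeomorphism U (\<phi> ` U) \<phi> (inv_into U \<phi>)"
proof -
  have "\<forall>(U, \<phi>)\<in>A. open U \<and> open (\<phi> ` U) \<and> homeomorphism U (\<phi> ` U) \<phi> (inv_into U \<phi>)"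
    using atlas unfolding smooth_atlas_def by blast
  then show "open U" "open (\<phi> ` U)" "homeomorphism U (\<phi> ` U) \<phi> (inv_into U \<phi>)"
    using assms by auto
qed

lemma chart_inv [simp]: "(U, \<phi>) \<in> A \<Longrightarrow> q \<in> U \<Longrightarrow> inv_into U \<phi> (\<phi> q) = q"
  using chart_homeomorphism homeomorphism_def by (metis (no_types, lifting))

lemma chart_transition:
  "(U, \<phi>) \<in> A \<Longrightarrow> (W, \<psi>) \<in> A \<Longrightarrow> smooth_on (\<phi> ` (U \<inter> W)) (\<psi> \<circ> inv_into U \<phi>)"
  using atlas unfolding smooth_atlas_def by fast

lemma chart_open_image:
  assumes "(U, \<phi>) \<in> A" "open M"
  shows "open (\<phi> ` (M \<inter> U))"
proof -
  have "\<phi> ` (M \<inter> U) = \<phi> ` U \<inter> inv_into U \<phi> -` M"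
    using chart_inv[OF assms(1)] by force
  moreover have "continuous_on (\<phi> ` U) (inv_into U \<phi>)"
    using chart_homeomorphism[OF assms(1)] by (simp add: homeomorphism_def)
  ultimately show ?thesis
    using continuous_open_preimage[OF _ chart_image_open[OF assms(1)] assms(2)] by simp
qed

lemma smooth_in_cong:
  assumes "open M" "\<And>q. q \<in> M \<Longrightarrow> f q = h q" "smooth_in A M f"
  shows "smooth_in A M h"
  unfolding smooth_in_def
proof (clarify)
  fix U \<phi> assume c: "(U, \<phi>) \<in> A"
  have "smooth_on (\<phi> ` (M \<inter> U)) (f \<circ> inv_into U \<phi>)"
    using assms(3) c by (auto simp: smooth_in_def)
  then show "smooth_on (\<phi> ` (M \<inter> U)) (h \<circ> inv_into U \<phi>)"
    by (rule smooth_on_cong[OF chart_open_image[OF c assms(1)], rotated])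
      (auto simp: assms(2) c)
qed

lemma smooth_in_local:
  assumes "\<And>q. q \<in> M \<Longrightarrow> \<exists>N. open N \<and> q \<in> N \<and> smooth_in A N f"
  shows "smooth_in A M f"
  unfolding smooth_in_def
proof (clarify)
  fix U \<phi> assume c: "(U, \<phi>) \<in> A"
  show "smooth_on (\<phi> ` (M \<inter> U)) (f \<circ> inv_into U \<phi>)"
  proof (rule smooth_on_local)
    fix x assume "x \<in> \<phi> ` (M \<inter> U)"
    then obtain q where q: "q \<in> M" "q \<in> U" "x = \<phi> q" by blast
    from assms[OF q(1)] obtain N where N: "open N" "q \<in> N" "smooth_in A N f" by blast
    show "\<exists>T. open T \<and> x \<in> T \<and> smooth_on T (f \<circ> inv_into U \<phi>)"
      using chart_open_image[OF c N(1)] N q c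
      by (intro exI[of _ "\<phi> ` (N \<inter> U)"]) (auto simp: smooth_in_def)
  qed
qed

lemma smooth_fun_local:
  assumes "\<And>q. \<exists>N f'. open N \<and> q \<in> N \<and> smooth_in A N f' \<and> (\<forall>r\<in>N. f r = f' r)"
  shows "smooth_fun A f"
  unfolding smooth_in_UNIV[symmetric]
proof (rule smooth_in_local)
  fix q
  from assms[of q] obtain N f' where "open N" "q \<in> N" "smooth_in A N f'" "\<forall>r\<in>N. f r = f' r"
    by blast
  then show "\<exists>N. open N \<and> q \<in> N \<and> smooth_in A N f"
    using smooth_in_cong[of N f' f] by auto
qed

lemma smooth_in_const: "open M \<Longrightarrow> smooth_in A M (\<lambda>q. c)"
  unfolding smooth_in_def by (auto simp: o_def intro: smooth_on_const chart_open_image)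

lemma smooth_in_add:
  "open M \<Longrightarrow> smooth_in A M f \<Longrightarrow> smooth_in A M h \<Longrightarrow> smooth_in A M (\<lambda>q. f q + h q)"
  unfolding smooth_in_def o_def by (fast intro: smooth_on_add chart_open_image)

lemma smooth_in_mult:
  "open M \<Longrightarrow> smooth_in A M f \<Longrightarrow> smooth_in A M h \<Longrightarrow> smooth_in A M (\<lambda>q. f q * h q)"
  unfolding smooth_in_def o_def by (fast intro: smooth_on_mult chart_open_image)

lemma smooth_in_powr:
  assumes "open M" "\<And>q. q \<in> M \<Longrightarrow> f q > 0" "smooth_in A M f"
  shows "smooth_in A M (\<lambda>q. f q powr a)"
  unfolding smooth_in_def
proof (clarify)
  fix U \<phi> assume c: "(U, \<phi>) \<in> A"
  show "smooth_on (\<phi> ` (M \<inter> U)) ((\<lambda>q. f q powr a) \<circ> inv_into U \<phi>)"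
    unfolding o_def
    by (rule smooth_on_powr) (use assms c in \<open>auto simp: smooth_in_def o_def intro: chart_open_image\<close>)
qed

lemma smooth_fun_const: "smooth_fun A (\<lambda>q. c)"
  using smooth_in_const smooth_in_UNIV open_UNIV by blast

lemma smooth_fun_add: "smooth_fun A f \<Longrightarrow> smooth_fun A h \<Longrightarrow> smooth_fun A (\<lambda>q. f q + h q)"
  using smooth_in_add smooth_in_UNIV open_UNIV by blast

lemma smooth_fun_mult: "smooth_fun A f \<Longrightarrow> smooth_fun A h \<Longrightarrow> smooth_fun A (\<lambda>q. f q * h q)"
  using smooth_in_mult smooth_in_UNIV open_UNIV by blast

lemma smooth_fun_sum:
  "finite I \<Longrightarrow> (\<And>i. i \<in> I \<Longrightarrow> smooth_fun A (f i)) \<Longrightarrow> smooth_fun A (\<lambda>q. \<Sum>i\<in>I. f i q)"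
  by (induction I rule: finite_induct) (simp_all add: smooth_fun_const smooth_fun_add)

text \<open>Here the compatibility of the atlas enters: read in any other chart, the function is
  \<open>u\<close> composed with a transition map.\<close>

lemma smooth_in_chart:
  assumes c: "(U, \<phi>) \<in> A" and M: "open M" "M \<subseteq> U" and u: "smooth_on (\<phi> ` M) u"
  shows "smooth_in A M (\<lambda>q. u (\<phi> q))"
  unfolding smooth_in_def
proof (clarify)
  fix W \<psi> assume d: "(W, \<psi>) \<in> A"
  have "smooth_on (\<psi> ` (M \<inter> W)) (\<lambda>x. u ((\<phi> \<circ> inv_into W \<psi>) x))"
  proof (rule smooth_on_compose[OF _ _ _ u])
    show "open (\<psi> ` (M \<inter> W))" by (rule chart_open_image[OF d M(1)])
    show "open (\<phi> ` M)" using chart_open_image[OF c M(1)] M(2) by (simp add: Int_absorb2)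
    show "(\<phi> \<circ> inv_into W \<psi>) ` \<psi> ` (M \<inter> W) \<subseteq> \<phi> ` M" by (auto simp: d)
    show "smooth_on (\<psi> ` (M \<inter> W)) (\<phi> \<circ> inv_into W \<psi>)"
      by (rule smooth_on_subset[OF chart_transition[OF d c]]) (use M(2) in auto)
  qed
  then show "smooth_on (\<psi> ` (M \<inter> W)) ((\<lambda>q. u (\<phi> q)) \<circ> inv_into W \<psi>)" by (simp add: o_def)
qed

text \<open>The open sets \<open>M\<close> and \<open>- C\<close> cover the manifold, and on the
  second one the function is identically 0. A closed \<open>C\<close> containing the support is
  therefore what has to be tracked.\<close>

lemma smooth_fun_extend_by_zero:
  assumes M: "open M" "smooth_in A M f" and C: "closed C" "C \<subseteq> M"
    and b: "smooth_fun A \<beta>" "\<And>q. q \<notin> C \<Longrightarrow> \<beta> q = 0"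
  shows "smooth_fun A (\<lambda>q. if q \<in> M then \<beta> q * f q else 0)"
proof (rule smooth_fun_local)
  fix q
  show "\<exists>N f'. open N \<and> q \<in> N \<and> smooth_in A N f' \<and> (\<forall>r\<in>N. (if r \<in> M then \<beta> r * f r else 0) = f' r)"
  proof (cases "q \<in> M")
    case True
    then show ?thesis
      by (intro exI[of _ M] exI[of _ "\<lambda>q. \<beta> q * f q"])
        (auto intro: smooth_in_mult M smooth_fun_imp_smooth_in b(1))
  next
    case False
    then show ?thesis
      by (intro exI[of _ "- C"] exI[of _ "\<lambda>q. 0"])
        (use C b(2) in \<open>auto intro: smooth_in_const\<close>)
  qed
qed

text \<open>Transports the Euclidean bump through a chart. The neighbourhood \<open>N\<close> is
  recorded as a coordinate ball because Hadamard's lemma will be applied on its convex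
  image.\<close>

lemma chart_bump:
  assumes c: "(U, \<phi>) \<in> A" and p: "p \<in> U" and M: "open M" "p \<in> M"
  obtains \<beta> C r N where "smooth_fun A \<beta>" "closed C" "C \<subseteq> M \<inter> U" "\<And>q. q \<notin> C \<Longrightarrow> \<beta> q = 0"
    "open N" "p \<in> N" "N \<subseteq> C" "\<phi> ` N = ball (\<phi> p) r" "\<And>q. q \<in> N \<Longrightarrow> \<beta> q = 1"
proof -
  have "open (\<phi> ` (M \<inter> U))" "\<phi> p \<in> \<phi> ` (M \<inter> U)"
    using chart_open_image[OF c M(1)] p M(2) by auto
  then obtain b r where r: "r > 0" "cball (\<phi> p) (2 * r) \<subseteq> \<phi> ` (M \<inter> U)"
    and b: "smooth_on UNIV b" "\<And>x. x \<in> ball (\<phi> p) r \<Longrightarrow> b x = (1::real)"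
      "\<And>x. x \<notin> cball (\<phi> p) (2 * r) \<Longrightarrow> b x = 0"
    by (rule smooth_bump) blast
  let ?inv = "inv_into U \<phi>"
  define C where "C = ?inv ` cball (\<phi> p) (2 * r)"
  define N where "N = U \<inter> \<phi> -` ball (\<phi> p) r"
  define \<beta> where "\<beta> q = (if q \<in> U then b (\<phi> q) else 0)" for q
  have inv: "\<phi> (?inv x) = x" if "x \<in> \<phi> ` U" for x
    using that by (rule f_inv_into_f)
  have mem: "q \<in> C \<longleftrightarrow> q \<in> U \<and> \<phi> q \<in> cball (\<phi> p) (2 * r)" for q
  proof
    assume "q \<in> C"
    then obtain x where x: "x \<in> cball (\<phi> p) (2 * r)" "q = ?inv x" by (auto simp: C_def)
    then have "x \<in> \<phi> ` U" using r(2) by blast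
    then show "q \<in> U \<and> \<phi> q \<in> cball (\<phi> p) (2 * r)"
      using x inv by (simp add: inv_into_into)
  next
    assume "q \<in> U \<and> \<phi> q \<in> cball (\<phi> p) (2 * r)"
    then show "q \<in> C" unfolding C_def using chart_inv[OF c] by (metis imageI)
  qed
  have "continuous_on (\<phi> ` U) ?inv" "continuous_on U \<phi>"
    using chart_homeomorphism[OF c] by (auto simp: homeomorphism_def)
  then have "compact C" unfolding C_def
    by (intro compact_continuous_image) (use r(2) in \<open>auto intro: continuous_on_subset\<close>)
  \<comment> \<open>The Hausdorff property is used here: \<open>C\<close> is closed in the whole
    manifold and not merely in the chart domain, so extension by zero is smooth.\<close>
  then have C: "closed C" by (rule compact_imp_closed)
  have CM: "C \<subseteq> M \<inter> U"
  proof
    fix q assume "q \<in> C"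
    then have "q \<in> U" "\<phi> q \<in> \<phi> ` (M \<inter> U)" using mem r(2) by auto
    then show "q \<in> M \<inter> U" using chart_inv[OF c] by (metis IntD1 IntD2 IntI imageE)
  qed
  have "open N" unfolding N_def
    by (rule continuous_open_preimage[OF \<open>continuous_on U \<phi>\<close> chart_open[OF c]]) simp
  have z: "\<beta> q = 0" if "q \<notin> C" for q
    using that b(3) by (auto simp: \<beta>_def mem)
  have "smooth_fun A \<beta>"
  proof (rule smooth_fun_local)
    fix q
    show "\<exists>N f'. open N \<and> q \<in> N \<and> smooth_in A N f' \<and> (\<forall>r\<in>N. \<beta> r = f' r)"
    proof (cases "q \<in> U")
      case True
      then show ?thesis
        by (intro exI[of _ U] exI[of _ "\<lambda>q. b (\<phi> q)"])
          (auto simp: \<beta>_def intro!: chart_open[OF c] smooth_in_chart[OF c] intro: smooth_on_subset[OF b(1)])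
    next
      case False
      then show ?thesis using CM
        by (intro exI[of _ "- C"] exI[of _ "\<lambda>q. 0"])
          (use C z in \<open>auto intro: smooth_in_const\<close>)
    qed
  qed
  moreover have "N \<subseteq> C" using r(1) by (auto simp: N_def mem)
  moreover have "\<phi> ` N = ball (\<phi> p) r"
  proof -
    have "ball (\<phi> p) r \<subseteq> \<phi> ` U" using r ball_subset_cball[of "\<phi> p" "2 * r"] subset_ball[of r "2 * r" "\<phi> p"] by fastforce
    then show ?thesis by (auto simp: N_def)
  qed
  ultimately show thesis
    using that[of \<beta> C N r] C CM z \<open>open N\<close> p r(1) b(2) by (auto simp: N_def \<beta>_def)
qed

end

section \<open>Derivation rules for vector fields\<close>

lemma
  assumes "vector_field A X"
  shows vector_field_smooth: "smooth_fun A f \<Longrightarrow> smooth_fun A (X f)"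
    and vector_field_add: "smooth_fun A f \<Longrightarrow> smooth_fun A h \<Longrightarrow> X (\<lambda>p. f p + h p) q = X f q + X h q"
    and vector_field_cmult: "smooth_fun A f \<Longrightarrow> X (\<lambda>p. c * f p) q = c * X f q"
    and vector_field_mult: "smooth_fun A f \<Longrightarrow> smooth_fun A h \<Longrightarrow>
      X (\<lambda>p. f p * h p) q = f q * X h q + X f q * h q"
    and vector_field_nonsmooth: "\<not> smooth_fun A f \<Longrightarrow> X f q = 0"
  using assms by (simp_all add: vector_field_def)

context smooth_manifold
begin

lemma vector_field_const:
  assumes "vector_field A X"
  shows "X (\<lambda>p. c) q = 0"
proof -
  have "X (\<lambda>p. 1 * 1) q = X (\<lambda>p. 1) q + X (\<lambda>p. 1) q"
    using vector_field_mult[OF assms smooth_fun_const smooth_fun_const, of 1 1 q] by simp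
  then have "X (\<lambda>p. 1) q = 0" by simp
  then show ?thesis using vector_field_cmult[OF assms smooth_fun_const, of c 1 q] by simp
qed

lemma vector_field_sum:
  assumes "vector_field A X" "finite I" "\<And>i. i \<in> I \<Longrightarrow> smooth_fun A (f i)"
  shows "X (\<lambda>p. \<Sum>i\<in>I. f i p) q = (\<Sum>i\<in>I. X (f i) q)"
  using assms(2,3)
  by (induction I rule: finite_induct)
    (simp_all add: vector_field_const assms(1) vector_field_add[OF assms(1)] smooth_fun_sum)

lemma vector_fieldI:
  assumes "\<And>f. smooth_fun A f \<Longrightarrow> smooth_fun A (X f)"
    and "\<And>f h q. smooth_fun A f \<Longrightarrow> smooth_fun A h \<Longrightarrow> X (\<lambda>p. f p + h p) q = X f q + X h q"
    and "\<And>f h q. smooth_fun A f \<Longrightarrow> smooth_fun A h \<Longrightarrow>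
      X (\<lambda>p. f p * h p) q = f q * X h q + X f q * h q"
    and "\<And>c f q. smooth_fun A f \<Longrightarrow> X (\<lambda>p. c * f p) q = c * X f q"
    and "\<And>f q. \<not> smooth_fun A f \<Longrightarrow> X f q = 0"
  shows "vector_field A X"
  using assms by (simp add: vector_field_def fun_eq_iff)

end

section \<open>Coordinate fields and the local expansion of derivations\<close>

lemma sum_Basis_axis:
  fixes F :: "real ^ 'n::finite \<Rightarrow> real"
  shows "(\<Sum>b\<in>Basis. F b) = (\<Sum>i\<in>UNIV. F (axis i 1))"
proof -
  have basis: "Basis = (\<lambda>i. axis i (1::real)) ` (UNIV :: 'n set)" by (auto simp: Basis_vec_def)
  have inj: "inj (\<lambda>i::'n. axis i (1::real))" by (auto simp: inj_def axis_eq_axis)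
  show ?thesis unfolding basis by (simp add: sum.reindex[OF inj])
qed

context smooth_manifold
begin

text \<open>The coordinate derivative in direction \<open>i\<close>, cut off by \<beta> and extended
  by zero. The test on \<open>h\<close> respects the convention that vector fields send non-smooth
  functions to zero.\<close>

definition chart_field :: "('a, 'n) chart \<Rightarrow> ('a \<Rightarrow> real) \<Rightarrow> 'n \<Rightarrow> 'a vfield" where
  "chart_field = (\<lambda>(U, \<phi>) \<beta> i h q. if smooth_fun A h \<and> q \<in> U
     then \<beta> q * frechet_derivative (h \<circ> inv_into U \<phi>) (at (\<phi> q)) (axis i 1) else 0)"

lemma vector_field_chart_field:
  assumes c: "(U, \<phi>) \<in> A" and b: "smooth_fun A \<beta>" "closed C" "C \<subseteq> U" "\<And>q. q \<notin> C \<Longrightarrow> \<beta> q = 0"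
  shows "vector_field A (chart_field (U, \<phi>) \<beta> i)"
proof (rule vector_fieldI)
  let ?d = "\<lambda>h q. frechet_derivative (h \<circ> inv_into U \<phi>) (at (\<phi> q))"
  have sm: "smooth_on (\<phi> ` U) (h \<circ> inv_into U \<phi>)" if "smooth_fun A h" for h
    using that c by (auto simp: smooth_fun_def)
  have d: "((h \<circ> inv_into U \<phi>) has_derivative ?d h q) (at (\<phi> q))" if "smooth_fun A h" "q \<in> U" for h q
    by (rule smooth_on_has_derivative[OF sm[OF that(1)]]) (use that in simp)
  fix h assume h: "smooth_fun A h"
  have "smooth_in A U (\<lambda>q. ?d h q (axis i 1))"
    by (rule smooth_in_chart[OF c chart_open[OF c] order_refl])
      (rule smooth_on_frechet_derivative[OF sm[OF h]])
  from smooth_fun_extend_by_zero[OF chart_open[OF c] this b(2,3,1,4)]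
  show "smooth_fun A (chart_field (U, \<phi>) \<beta> i h)"
    using h by (simp add: chart_field_def)
  show "chart_field (U, \<phi>) \<beta> i (\<lambda>p. a * h p) q = a * chart_field (U, \<phi>) \<beta> i h q" for a q
  proof (cases "q \<in> U")
    case True
    have "((\<lambda>p. a * h p) \<circ> inv_into U \<phi> has_derivative (\<lambda>v. a * ?d h q v)) (at (\<phi> q))"
      using has_derivative_mult_right[OF d[OF h True], of a] by (simp add: o_def)
    from frechet_derivative_at[OF this, symmetric] show ?thesis
      using h True smooth_fun_mult[OF smooth_fun_const h, of a] by (simp add: chart_field_def)
  qed (simp add: chart_field_def)
  fix k assume k: "smooth_fun A k"
  show "chart_field (U, \<phi>) \<beta> i (\<lambda>p. h p + k p) q = chart_field (U, \<phi>) \<beta> i h q + chart_field (U, \<phi>) \<beta> i k q" for q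
  proof (cases "q \<in> U")
    case True
    have "((\<lambda>p. h p + k p) \<circ> inv_into U \<phi> has_derivative (\<lambda>v. ?d h q v + ?d k q v)) (at (\<phi> q))"
      using has_derivative_add[OF d[OF h True] d[OF k True]] by (simp add: o_def)
    from frechet_derivative_at[OF this, symmetric] show ?thesis
      using h k True smooth_fun_add[OF h k] by (simp add: chart_field_def distrib_left)
  qed (simp add: chart_field_def)
  show "chart_field (U, \<phi>) \<beta> i (\<lambda>p. h p * k p) q
      = h q * chart_field (U, \<phi>) \<beta> i k q + chart_field (U, \<phi>) \<beta> i h q * k q" for q
  proof (cases "q \<in> U")
    case True
    have "((\<lambda>p. h p * k p) \<circ> inv_into U \<phi> has_derivative (\<lambda>v. h q * ?d k q v + ?d h q v * k q)) (at (\<phi> q))"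
      using has_derivative_mult[OF d[OF h True] d[OF k True]] True by (simp add: o_def c)
    from frechet_derivative_at[OF this, symmetric] show ?thesis
      using h k True smooth_fun_mult[OF h k] by (simp add: chart_field_def algebra_simps)
  qed (simp add: chart_field_def)
qed (simp add: chart_field_def)

text \<open>Applying \<open>X\<close> to Hadamard's expansion of \<open>h\<close> at
  \<open>q\<close> kills the constant and leaves \<open>X (y i)\<close> times a partial derivative
  of \<open>h\<close>. The expansion is available at every \<open>q\<close> in \<open>N\<close>, not
  only at \<open>p\<close>, because the chart image of \<open>N\<close> is convex; with it the
  components \<open>X (y i)\<close> are smooth functions and not just numbers at
  \<open>p\<close>.\<close>

lemma coordinate_frame:
  obtains y :: "'n \<Rightarrow> 'a \<Rightarrow> real" and B N where "open N" "p \<in> N"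
    "\<And>i. smooth_fun A (y i)" "\<And>i. vector_field A (B i)"
    "\<And>i j. B i (y j) p = (if i = j then 1 else 0)"
    "\<And>X h q. vector_field A X \<Longrightarrow> smooth_fun A h \<Longrightarrow> q \<in> N \<Longrightarrow>
       X h q = (\<Sum>i\<in>UNIV. X (y i) q * B i h q)"
proof -
  obtain U \<phi> where c: "(U, \<phi>) \<in> A" and p: "p \<in> U" by (rule chart_at)
  obtain \<beta> C r N where b: "smooth_fun A \<beta>" "closed C" "C \<subseteq> UNIV \<inter> U" "\<And>q. q \<notin> C \<Longrightarrow> \<beta> q = 0"
    "open N" "p \<in> N" "N \<subseteq> C" "\<phi> ` N = ball (\<phi> p) r" "\<And>q. q \<in> N \<Longrightarrow> \<beta> q = 1"
    using chart_bump[OF c p open_UNIV UNIV_I] by metis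
  have CU: "C \<subseteq> U" using b(3) by simp
  have NU: "N \<subseteq> U" using b(3,7) by blast
  define y where "y i q = (if q \<in> U then \<beta> q * \<phi> q $ i else 0)" for i q
  define B where "B i = chart_field (U, \<phi>) \<beta> i" for i
  have sy: "smooth_fun A (y i)" for i
  proof -
    have "smooth_on (\<phi> ` U) (\<lambda>x. x $ i)"
      by (rule smooth_on_bounded_linear[OF bounded_linear_vec_nth chart_image_open[OF c]])
    from smooth_fun_extend_by_zero[OF chart_open[OF c] smooth_in_chart[OF c chart_open[OF c] order_refl this]
        b(2) CU b(1,4)]
    show ?thesis by (simp add: y_def[abs_def])
  qed
  have B: "vector_field A (B i)" for i
    unfolding B_def by (rule vector_field_chart_field[OF c b(1,2) CU b(4)])
  have yN: "y i q = \<phi> q $ i" if "q \<in> N" for i q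
    using that NU b(9) by (auto simp: y_def)
  have dual: "B i (y j) p = (if i = j then 1 else 0)" for i j
  proof -
    have "((y j \<circ> inv_into U \<phi>) has_derivative (\<lambda>v. v $ j)) (at (\<phi> p))"
    proof (rule has_derivative_transform_within_open)
      show "((\<lambda>x. x $ j) has_derivative (\<lambda>v. v $ j)) (at (\<phi> p))"
        by (rule bounded_linear_imp_has_derivative[OF bounded_linear_vec_nth])
      show "open (\<phi> ` N)" by (simp add: b(8))
      show "\<phi> p \<in> \<phi> ` N" using b(6) by simp
      show "x $ j = (y j \<circ> inv_into U \<phi>) x" if "x \<in> \<phi> ` N" for x
        using that yN NU c by auto
    qed
    from frechet_derivative_at[OF this, symmetric] show ?thesis
      using p b(6,9) by (simp add: B_def chart_field_def sy axis_def)
  qed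
  show thesis
  proof (rule that[OF b(5,6) sy B dual])
    fix X h q assume X: "vector_field A X" and h: "smooth_fun A h" and q: "q \<in> N"
    have qU: "q \<in> U" using q NU by blast
    \<comment> \<open>A second bump, centred at the arbitrary point \<open>q\<close>: the Hadamard
      coefficients live only on the coordinate ball, so the cut-off must be supported inside
      \<open>N\<close>, whereas \<beta> equals 1 on all of \<open>N\<close>.\<close>
    obtain \<gamma> C' r' N' where g: "smooth_fun A \<gamma>" "closed C'" "C' \<subseteq> N \<inter> U" "\<And>q. q \<notin> C' \<Longrightarrow> \<gamma> q = 0"
      "open N'" "q \<in> N'" "N' \<subseteq> C'" "\<phi> ` N' = ball (\<phi> q) r'" "\<And>q. q \<in> N' \<Longrightarrow> \<gamma> q = 1"
      using chart_bump[OF c qU b(5) q] by metis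
    have CN: "C' \<subseteq> N" using g(3) by blast
    have \<gamma>q: "\<gamma> q = 1" using g(6,9) by simp
    let ?H = "h \<circ> inv_into U \<phi>"
    have "smooth_on (\<phi> ` N) ?H"
      using h c NU by (auto simp: smooth_fun_def intro: smooth_on_subset)
    then have H: "smooth_on (ball (\<phi> p) r) ?H" by (simp only: b(8))
    have q': "\<phi> q \<in> ball (\<phi> p) r" using q b(8) by blast
    obtain k where k: "\<And>b. smooth_on (ball (\<phi> p) r) (k b)"
        "\<And>b. k b (\<phi> q) = frechet_derivative ?H (at (\<phi> q)) b"
        "\<And>x. x \<in> ball (\<phi> p) r \<Longrightarrow> ?H x = ?H (\<phi> q) + (\<Sum>b\<in>Basis. ((x - \<phi> q) \<bullet> b) * k b x)"
      by (rule hadamard[OF open_ball convex_ball q' H]) blast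
    define K where "K i z = (if z \<in> N then \<gamma> z * k (axis i 1) (\<phi> z) else 0)" for i z
    have sK: "smooth_fun A (K i)" for i
      unfolding K_def[abs_def]
      by (rule smooth_fun_extend_by_zero[OF b(5) smooth_in_chart[OF c b(5) NU] g(2) CN g(1,4)])
        (simp only: b(8) k(1))
    let ?Y = "\<lambda>i z. \<gamma> z * (y i z + (- y i q))"
    have sY0: "smooth_fun A (\<lambda>z. y i z + (- y i q))" for i
      by (intro smooth_fun_add sy smooth_fun_const)
    have sY: "smooth_fun A (?Y i)" for i
      by (intro smooth_fun_mult g(1) sY0)
    have sg: "smooth_fun A (\<lambda>z. \<gamma> z * \<gamma> z)"
      by (intro smooth_fun_mult g(1))
    \<comment> \<open>Cut off by \<open>\<gamma>\<^sup>2\<close>, Hadamard's expansion of \<open>h\<close> at \<open>q\<close> becomes an identity of global smooth functions,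
      to which \<open>X\<close> can be applied.\<close>
    have eq: "(\<lambda>z. (\<gamma> z * \<gamma> z) * h z) = (\<lambda>z. h q * (\<gamma> z * \<gamma> z) + (\<Sum>i\<in>UNIV. ?Y i z * K i z))"
    proof
      fix z
      show "(\<gamma> z * \<gamma> z) * h z = h q * (\<gamma> z * \<gamma> z) + (\<Sum>i\<in>UNIV. ?Y i z * K i z)"
      proof (cases "z \<in> N")
        case True
        then have z: "z \<in> U" "\<phi> z \<in> ball (\<phi> p) r" using NU b(8) by auto
        have "h z = h q + (\<Sum>i\<in>UNIV. (y i z + (- y i q)) * k (axis i 1) (\<phi> z))"
          using k(3)[OF z(2)] z(1) qU True q c by (simp add: sum_Basis_axis inner_axis yN)
        moreover have "(\<Sum>i\<in>UNIV. ?Y i z * K i z)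
            = (\<gamma> z * \<gamma> z) * (\<Sum>i\<in>UNIV. (y i z + (- y i q)) * k (axis i 1) (\<phi> z))"
          using True by (simp add: K_def sum_distrib_left mult_ac)
        ultimately show ?thesis by (simp add: algebra_simps)
      next
        case False
        then have "\<gamma> z = 0" using g(4) CN by blast
        then show ?thesis by simp
      qed
    qed
    have L: "X (\<lambda>z. (\<gamma> z * \<gamma> z) * h z) q = X h q + X (\<lambda>z. \<gamma> z * \<gamma> z) q * h q"
      using vector_field_mult[OF X sg h, of q] \<gamma>q by simp
    have "X (\<lambda>z. h q * (\<gamma> z * \<gamma> z) + (\<Sum>i\<in>UNIV. ?Y i z * K i z)) q
        = h q * X (\<lambda>z. \<gamma> z * \<gamma> z) q + (\<Sum>i\<in>UNIV. X (\<lambda>z. ?Y i z * K i z) q)"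
    proof -
      have "X (\<lambda>z. h q * (\<gamma> z * \<gamma> z) + (\<Sum>i\<in>UNIV. ?Y i z * K i z)) q
          = X (\<lambda>z. h q * (\<gamma> z * \<gamma> z)) q + X (\<lambda>z. \<Sum>i\<in>UNIV. ?Y i z * K i z) q"
        by (rule vector_field_add[OF X]) (intro smooth_fun_sum smooth_fun_mult smooth_fun_const sg sY sK finite)+
      also have "X (\<lambda>z. h q * (\<gamma> z * \<gamma> z)) q = h q * X (\<lambda>z. \<gamma> z * \<gamma> z) q"
        by (rule vector_field_cmult[OF X sg])
      also have "X (\<lambda>z. \<Sum>i\<in>UNIV. ?Y i z * K i z) q = (\<Sum>i\<in>UNIV. X (\<lambda>z. ?Y i z * K i z) q)"
        by (rule vector_field_sum[OF X finite]) (intro smooth_fun_mult[OF sY sK])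
      finally show ?thesis .
    qed
    \<comment> \<open>By the Leibniz rule only the term in which \<open>X\<close> hits
      \<open>?Y i\<close> survives, since \<open>?Y i\<close> vanishes at \<open>q\<close>.\<close>
    moreover have "X (\<lambda>z. ?Y i z * K i z) q = X (y i) q * B i h q" for i
    proof -
      have "X (\<lambda>z. y i z + (- y i q)) q = X (y i) q"
        using vector_field_add[OF X sy smooth_fun_const, of i "- y i q" q] vector_field_const[OF X]
        by simp
      then have "X (?Y i) q = X (y i) q"
        using vector_field_mult[OF X g(1) sY0, of i q] \<gamma>q by simp
      moreover have "K i q = B i h q"
        using q qU \<gamma>q h b(9) by (simp add: K_def B_def chart_field_def k(2))
      ultimately show ?thesis
        using vector_field_mult[OF X sY sK, of i i q] by simp
    qed
    ultimately show "X h q = (\<Sum>i\<in>UNIV. X (y i) q * B i h q)"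
      using L unfolding eq by (simp add: mult.commute)
  qed
qed

end

section \<open>Tensoriality, orthonormal frames and gradients\<close>

context smooth_manifold
begin

lemma vector_field_zero: "vector_field A (\<lambda>h q. 0)"
  by (rule vector_fieldI) (simp_all add: smooth_fun_const)

lemma vector_field_vf_add:
  assumes "vector_field A X" "vector_field A Y"
  shows "vector_field A (vf_add X Y)"
proof (rule vector_fieldI)
  show "smooth_fun A f \<Longrightarrow> smooth_fun A (vf_add X Y f)" for f
    using assms by (simp add: vf_add_def smooth_fun_add vector_field_smooth)
qed (simp_all add: vf_add_def vector_field_add[OF assms(1)] vector_field_add[OF assms(2)]
  vector_field_mult[OF assms(1)] vector_field_mult[OF assms(2)]
  vector_field_cmult[OF assms(1)] vector_field_cmult[OF assms(2)]
  vector_field_nonsmooth[OF assms(1)] vector_field_nonsmooth[OF assms(2)] algebra_simps)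

lemma vector_field_vf_scale:
  assumes "smooth_fun A f" "vector_field A X"
  shows "vector_field A (vf_scale f X)"
proof (rule vector_fieldI)
  show "smooth_fun A h \<Longrightarrow> smooth_fun A (vf_scale f X h)" for h
    using assms by (simp add: vf_scale_def smooth_fun_mult vector_field_smooth)
qed (simp_all add: vf_scale_def vector_field_add[OF assms(2)] vector_field_mult[OF assms(2)]
  vector_field_cmult[OF assms(2)] vector_field_nonsmooth[OF assms(2)] algebra_simps)

lemma vf_diff_eq: "vf_diff X Y = vf_add X (vf_scale (\<lambda>q. - 1) Y)"
  by (simp add: vf_diff_def vf_add_def vf_scale_def)

lemma vector_field_vf_diff:
  "vector_field A X \<Longrightarrow> vector_field A Y \<Longrightarrow> vector_field A (vf_diff X Y)"
  unfolding vf_diff_eq by (intro vector_field_vf_add vector_field_vf_scale smooth_fun_const)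

definition vf_lincomb :: "'i set \<Rightarrow> ('i \<Rightarrow> 'a \<Rightarrow> real) \<Rightarrow> ('i \<Rightarrow> 'a vfield) \<Rightarrow> 'a vfield" where
  "vf_lincomb I f B = (\<lambda>h q. \<Sum>i\<in>I. f i q * B i h q)"

lemma vf_lincomb_insert:
  "finite I \<Longrightarrow> k \<notin> I \<Longrightarrow> vf_lincomb (insert k I) f B = vf_add (vf_scale (f k) (B k)) (vf_lincomb I f B)"
  by (simp add: vf_lincomb_def vf_add_def vf_scale_def)

lemma vector_field_vf_lincomb:
  assumes "finite I" "\<And>i. i \<in> I \<Longrightarrow> smooth_fun A (f i)" "\<And>i. i \<in> I \<Longrightarrow> vector_field A (B i)"
  shows "vector_field A (vf_lincomb I f B)"
  using assms
  by (induction I rule: finite_induct)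
    (simp_all add: vf_lincomb_insert vector_field_vf_add vector_field_vf_scale,
     simp add: vf_lincomb_def vector_field_zero)

text \<open>Linearity over smooth functions with coefficients evaluated at \<open>p\<close>: these
  functionals turn out to be the covectors at \<open>p\<close>, although they are defined on global
  fields.\<close>

definition tensorial_at :: "'a \<Rightarrow> ('a vfield \<Rightarrow> real) \<Rightarrow> bool" where
  "tensorial_at p T \<longleftrightarrow>
     (\<forall>X Y. vector_field A X \<longrightarrow> vector_field A Y \<longrightarrow> T (vf_add X Y) = T X + T Y) \<and>
     (\<forall>f X. smooth_fun A f \<longrightarrow> vector_field A X \<longrightarrow> T (vf_scale f X) = f p * T X)"

lemma tensorial_atD:
  assumes "tensorial_at p T" "vector_field A X"
  shows "vector_field A Y \<Longrightarrow> T (vf_add X Y) = T X + T Y"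
    and "smooth_fun A f \<Longrightarrow> T (vf_scale f X) = f p * T X"
  using assms by (auto simp: tensorial_at_def)

lemma tensorial_at_vf_diff:
  assumes "tensorial_at p T" "vector_field A X" "vector_field A Y"
  shows "T (vf_diff X Y) = T X - T Y"
  unfolding vf_diff_eq using assms
  by (simp add: tensorial_atD vector_field_vf_scale smooth_fun_const)

lemma tensorial_at_vf_lincomb:
  assumes T: "tensorial_at p T"
    and "finite I" "\<And>i. i \<in> I \<Longrightarrow> smooth_fun A (f i)" "\<And>i. i \<in> I \<Longrightarrow> vector_field A (B i)"
  shows "T (vf_lincomb I f B) = (\<Sum>i\<in>I. f i p * T (B i))"
  using assms(2-4)
proof (induction I rule: finite_induct)
  case empty
  have "vf_lincomb {} f B = vf_scale (\<lambda>q. 0) (\<lambda>h q. 0)"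
    by (simp add: vf_lincomb_def vf_scale_def)
  then show ?case
    using tensorial_atD(2)[OF T vector_field_zero smooth_fun_const] by simp
next
  case (insert k I)
  then show ?case
    by (simp add: vf_lincomb_insert tensorial_atD[OF T] vector_field_vf_scale vector_field_vf_lincomb)
qed

lemma bump_at:
  assumes "open M" "p \<in> M"
  obtains \<beta> C N where "smooth_fun A \<beta>" "closed C" "C \<subseteq> M" "\<And>q. q \<notin> C \<Longrightarrow> \<beta> q = 0"
    "open N" "p \<in> N" "N \<subseteq> C" "\<And>q. q \<in> N \<Longrightarrow> \<beta> q = 1"
proof -
  obtain U \<phi> where "(U, \<phi>) \<in> A" "p \<in> U" by (rule chart_at)
  from chart_bump[OF this assms] show thesis using that by (metis le_inf_iff)
qed

text \<open>Near \<open>p\<close> the field is a combination of coordinate fields whose coefficients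
  \<open>X (y i)\<close> vanish at \<open>p\<close>, and \<open>T\<close> only sees the values of
  the coefficients there. Multiplying by a bump equal to 1 at \<open>p\<close> makes the combination
  a global identity without changing \<open>T X\<close>.\<close>

lemma tensorial_at_vanish:
  assumes T: "tensorial_at p T" and X: "vector_field A X" and 0: "\<And>h. X h p = 0"
  shows "T X = 0"
proof -
  obtain y B N where N: "open N" "p \<in> N" and y: "\<And>i::'n. smooth_fun A (y i)"
    and B: "\<And>i. vector_field A (B i)"
    and rep: "\<And>X h q. vector_field A X \<Longrightarrow> smooth_fun A h \<Longrightarrow> q \<in> N \<Longrightarrow>
       X h q = (\<Sum>i\<in>UNIV. X (y i) q * B i h q)"
    by (rule coordinate_frame[of p]) blast
  obtain \<beta> C N' where b: "smooth_fun A \<beta>" "C \<subseteq> N" "\<And>q. q \<notin> C \<Longrightarrow> \<beta> q = 0"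
    "p \<in> N'" "\<And>q. q \<in> N' \<Longrightarrow> \<beta> q = 1"
    by (rule bump_at[OF N]) blast
  \<comment> \<open>The identity must hold for all arguments: off \<open>N\<close> the bump
    vanishes, and on non-smooth \<open>h\<close> both sides are zero by convention.\<close>
  have "vf_scale \<beta> X = vf_lincomb UNIV (\<lambda>i q. \<beta> q * X (y i) q) B"
  proof (intro ext)
    fix h q
    show "vf_scale \<beta> X h q = vf_lincomb UNIV (\<lambda>i q. \<beta> q * X (y i) q) B h q"
    proof (cases "smooth_fun A h \<and> q \<in> N")
      case True
      then show ?thesis using rep[OF X, of h q]
        by (simp add: vf_scale_def vf_lincomb_def sum_distrib_left mult.assoc)
    next
      case False
      then consider "\<not> smooth_fun A h" | "\<beta> q = 0" using b(2,3) by blast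
      then show ?thesis
        by cases (simp_all add: vf_scale_def vf_lincomb_def vector_field_nonsmooth[OF X] vector_field_nonsmooth[OF B])
    qed
  qed
  then have "T (vf_scale \<beta> X) = (\<Sum>i\<in>UNIV. (\<beta> p * X (y i) p) * T (B i))"
    by (simp add: tensorial_at_vf_lincomb[OF T] smooth_fun_mult b(1) vector_field_smooth[OF X] y B)
  then show ?thesis
    using tensorial_atD(2)[OF T X b(1)] b(4,5) 0 by simp
qed

text \<open>The numbers \<open>c i\<close> become constant functions; the field obtained by
  subtracting the combination vanishes at \<open>p\<close>, so \<open>T\<close> annihilates it. This
  reduces statements about tensors to linear algebra at one point.\<close>

lemma tensorial_at_eq_sum:
  assumes T: "tensorial_at p T" and X: "vector_field A X"
    and E: "\<And>i. i \<in> I \<Longrightarrow> vector_field A (E i)" "finite I"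
    and eq: "\<And>h. smooth_fun A h \<Longrightarrow> X h p = (\<Sum>i\<in>I. c i * E i h p)"
  shows "T X = (\<Sum>i\<in>I. c i * T (E i))"
proof -
  let ?L = "vf_lincomb I (\<lambda>i q. c i) E"
  have L: "vector_field A ?L"
    by (intro vector_field_vf_lincomb E smooth_fun_const)
  have "vf_diff X ?L h p = 0" for h
    using eq[of h] vector_field_nonsmooth[OF X, of h] vector_field_nonsmooth[OF E(1), of _ h]
    by (cases "smooth_fun A h") (simp_all add: vf_diff_def vf_lincomb_def)
  then have "T (vf_diff X ?L) = 0"
    by (intro tensorial_at_vanish[OF T] vector_field_vf_diff X L)
  then show ?thesis
    using E by (simp add: tensorial_at_vf_diff[OF T X L] tensorial_at_vf_lincomb[OF T] smooth_fun_const)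
qed

text \<open>Derivations are local: with a bump \<beta> supported in \<open>U\<close>, the products
  of \<beta> with \<open>f\<close> and with \<open>h\<close> coincide globally, and the Leibniz rule
  at \<open>p\<close>, where \<beta> is 1, gives the claim. It allows identities valid only near a
  point to be differentiated there.\<close>

lemma vector_field_local:
  assumes X: "vector_field A X" and f: "smooth_fun A f" "smooth_fun A h"
    and U: "open U" "p \<in> U" "\<And>q. q \<in> U \<Longrightarrow> f q = h q"
  shows "X f p = X h p"
proof -
  obtain \<beta> C N where b: "smooth_fun A \<beta>" "C \<subseteq> U" "\<And>q. q \<notin> C \<Longrightarrow> \<beta> q = 0"
    "p \<in> N" "\<And>q. q \<in> N \<Longrightarrow> \<beta> q = 1"
    by (rule bump_at[OF U(1,2)]) blast
  have "(\<lambda>q. \<beta> q * f q) = (\<lambda>q. \<beta> q * h q)"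
    using b(2,3) U(3) by fastforce
  then show ?thesis
    using vector_field_mult[OF X b(1) f(1), of p] vector_field_mult[OF X b(1) f(2), of p] b(4,5) U(2,3)
    by simp
qed

lemma smooth_fun_continuous:
  assumes "smooth_fun A f"
  shows "continuous_on UNIV f"
proof -
  have "isCont f p" for p
  proof -
    obtain U \<phi> where c: "(U, \<phi>) \<in> A" and p: "p \<in> U" by (rule chart_at)
    have "smooth_on (\<phi> ` U) (f \<circ> inv_into U \<phi>)" using assms c by (auto simp: smooth_fun_def)
    then have "continuous_on (\<phi> ` U) (f \<circ> inv_into U \<phi>)" by (metis smooth_onD Ck_on.simps(1))
    moreover have "continuous_on U \<phi>" using chart_homeomorphism[OF c] by (simp add: homeomorphism_def)
    ultimately have "continuous_on U ((f \<circ> inv_into U \<phi>) \<circ> \<phi>)"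
      by (rule continuous_on_compose[rotated])
    then have "continuous_on U f"
      by (rule continuous_on_eq) (simp add: c)
    then show ?thesis using chart_open[OF c] p by (simp add: continuous_on_eq_continuous_at)
  qed
  then show ?thesis by (simp add: continuous_at_imp_continuous_on)
qed

end

section \<open>Orthonormal frames, traces and gradients of a Riemannian metric\<close>

locale riemannian_manifold = smooth_manifold A
  for A :: "('a::t2_space, 'n::finite) chart set" +
  fixes g :: "'a tensor2"
  assumes metric: "riemannian_metric A g"
begin

lemma metric_smooth: "vector_field A X \<Longrightarrow> vector_field A Y \<Longrightarrow> smooth_fun A (g X Y)"
  using metric by (simp add: riemannian_metric_def tensor_field2_def)

lemma metric_sym: "vector_field A X \<Longrightarrow> vector_field A Y \<Longrightarrow> g X Y p = g Y X p"
  using metric by (simp add: riemannian_metric_def)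

lemma metric_pos: "vector_field A X \<Longrightarrow> nonzero_at X p \<Longrightarrow> g X X p > 0"
  using metric by (simp add: riemannian_metric_def)

lemma tensorial_at_metric:
  assumes "vector_field A Y"
  shows "tensorial_at p (\<lambda>X. g X Y p)" "tensorial_at p (\<lambda>X. g Y X p)"
  using metric assms by (simp_all add: riemannian_metric_def tensor_field2_def tensorial_at_def)

text \<open>Orthonormality at the single point suffices for expansions and traces; a neighbourhood
  is needed only where the frame is differentiated.\<close>

definition orthonormal_at :: "'a \<Rightarrow> ('n \<Rightarrow> 'a vfield) \<Rightarrow> bool" where
  "orthonormal_at p E \<longleftrightarrow> (\<forall>i. vector_field A (E i)) \<and> (\<forall>i j. g (E i) (E j) p = (if i = j then 1 else 0))"

text \<open>The frame has as many members as there are coordinates. Inner products with the frame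
  recover the coefficients, so the map from coefficients to coordinate vectors is injective, hence
  surjective by dimension.\<close>

lemma orthonormal_at_expand:
  assumes E: "orthonormal_at p E" and X: "vector_field A X" and h: "smooth_fun A h"
  shows "X h p = (\<Sum>i\<in>UNIV. g X (E i) p * E i h p)"
proof -
  obtain y :: "'n \<Rightarrow> 'a \<Rightarrow> real" and B N where N: "p \<in> N"
    and rep: "\<And>X h q. vector_field A X \<Longrightarrow> smooth_fun A h \<Longrightarrow> q \<in> N \<Longrightarrow>
       X h q = (\<Sum>i\<in>UNIV. X (y i) q * B i h q)"
    by (rule coordinate_frame[of p]) blast
  have vE: "vector_field A (E i)" and gE: "g (E i) (E j) p = (if i = j then 1 else 0)" for i j
    using E by (auto simp: orthonormal_at_def)
  \<comment> \<open>\<open>e i\<close> is the coordinate vector of \<open>E i\<close> at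
    \<open>p\<close>, and \<open>L c\<close> below is that of the combination of the
    \<open>E i\<close> with coefficients \<open>c\<close>.\<close>
  define e :: "'n \<Rightarrow> real ^ 'n" where "e i = (\<chi> j. E i (y j) p)" for i
  define L :: "real ^ 'n \<Rightarrow> real ^ 'n" where "L c = (\<Sum>i\<in>UNIV. (c $ i) *\<^sub>R e i)" for c
  have lin: "linear L"
    by (rule linearI) (simp_all add: L_def scaleR_left_distrib sum.distrib scaleR_right.sum)
  have comb: "X h p = (\<Sum>i\<in>UNIV. c $ i * E i h p)"
    if X: "vector_field A X" and h: "smooth_fun A h" and c: "L c = (\<chi> j. X (y j) p)" for X h c
  proof -
    have "X (y j) p = (\<Sum>i\<in>UNIV. c $ i * E i (y j) p)" for j
      using arg_cong[OF c, of "\<lambda>v. v $ j"] by (simp add: L_def e_def)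
    then have "X h p = (\<Sum>j\<in>UNIV. \<Sum>i\<in>UNIV. c $ i * (E i (y j) p * B j h p))"
      using rep[OF X h N] by (simp add: sum_distrib_right mult.assoc)
    also have "\<dots> = (\<Sum>i\<in>UNIV. c $ i * (\<Sum>j\<in>UNIV. E i (y j) p * B j h p))"
      by (subst sum.swap) (simp add: sum_distrib_left)
    finally show ?thesis using rep[OF vE h N] by simp
  qed
  have coeff: "c $ j = g X (E j) p" if X: "vector_field A X" and c: "L c = (\<chi> j. X (y j) p)" for X c j
  proof -
    have "g X (E j) p = (\<Sum>i\<in>UNIV. c $ i * g (E i) (E j) p)"
      by (rule tensorial_at_eq_sum[OF tensorial_at_metric(1)[OF vE] X vE finite comb[OF X _ c]])
    then show ?thesis by (simp add: gE if_distrib cong: if_cong)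
  qed
  have "inj L"
  proof (rule linear_injective_0[OF lin, THEN iffD2], intro allI impI)
    fix c assume "L c = 0"
    then have "L c = (\<chi> j. (\<lambda>h q. 0) (y j) p)" by (simp add: vec_eq_iff)
    from coeff[OF vector_field_zero this]
    have "c $ j = g (\<lambda>h q. 0) (E j) p" for j .
    also have "g (\<lambda>h q. 0) (E j) p = 0" for j
      by (rule tensorial_at_vanish[OF tensorial_at_metric(1)[OF vE] vector_field_zero]) simp
    finally show "c = 0" by (simp add: vec_eq_iff)
  qed
  then have "surj L" using lin linear_injective_imp_surjective by blast
  then obtain c where c: "L c = (\<chi> j. X (y j) p)" by (metis surjD)
  show ?thesis using comb[OF X h c] coeff[OF X c] by simp
qed

lemma orthonormal_at_tensorial:
  assumes "tensorial_at p T" "orthonormal_at p E" "vector_field A X"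
  shows "T X = (\<Sum>i\<in>UNIV. g X (E i) p * T (E i))"
proof (rule tensorial_at_eq_sum[OF assms(1,3)])
  show "vector_field A (E i)" for i
    using assms(2) by (simp add: orthonormal_at_def)
  show "X h p = (\<Sum>i\<in>UNIV. g X (E i) p * E i h p)" if "smooth_fun A h" for h
    by (rule orthonormal_at_expand[OF assms(2,3) that])
qed simp

text \<open>Expanding both arguments in \<open>E\<close> produces the product of the change-of-frame
  matrix with its transpose; it is the identity, by the expansion of \<open>E j\<close> in the frame
  \<open>F\<close>.\<close>

lemma trace_frame_independent:
  assumes T1: "\<And>Y. vector_field A Y \<Longrightarrow> tensorial_at p (\<lambda>X. T X Y)"
    and T2: "\<And>X. vector_field A X \<Longrightarrow> tensorial_at p (T X)"
    and E: "orthonormal_at p E" and F: "orthonormal_at p F"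
  shows "(\<Sum>i\<in>UNIV. T (F i) (F i)) = (\<Sum>i\<in>UNIV. T (E i) (E i))"
proof -
  have vE: "vector_field A (E i)" and gE: "g (E i) (E j) p = (if i = j then 1 else 0)" for i j
    using E by (auto simp: orthonormal_at_def)
  have vF: "vector_field A (F i)" for i
    using F by (auto simp: orthonormal_at_def)
  have "T (F i) (F i) = (\<Sum>j\<in>UNIV. \<Sum>k\<in>UNIV. (g (E j) (F i) p * g (F i) (E k) p) * T (E j) (E k))" for i
  proof -
    have "T (F i) (F i) = (\<Sum>j\<in>UNIV. g (F i) (E j) p * T (E j) (F i))"
      by (rule orthonormal_at_tensorial[OF T1[OF vF] E vF])
    also have "\<dots> = (\<Sum>j\<in>UNIV. g (F i) (E j) p * (\<Sum>k\<in>UNIV. g (F i) (E k) p * T (E j) (E k)))"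
      by (subst orthonormal_at_tensorial[OF T2[OF vE] E vF]) (rule refl)
    finally show ?thesis
      by (simp add: sum_distrib_left mult.assoc metric_sym[OF vF vE])
  qed
  then have "(\<Sum>i\<in>UNIV. T (F i) (F i))
      = (\<Sum>i\<in>UNIV. \<Sum>j\<in>UNIV. \<Sum>k\<in>UNIV. (g (E j) (F i) p * g (F i) (E k) p) * T (E j) (E k))"
    by simp
  also have "\<dots> = (\<Sum>j\<in>UNIV. \<Sum>i\<in>UNIV. \<Sum>k\<in>UNIV. (g (E j) (F i) p * g (F i) (E k) p) * T (E j) (E k))"
    by (rule sum.swap)
  also have "\<dots> = (\<Sum>j\<in>UNIV. \<Sum>k\<in>UNIV. \<Sum>i\<in>UNIV. (g (E j) (F i) p * g (F i) (E k) p) * T (E j) (E k))"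
    by (rule sum.cong[OF refl sum.swap])
  also have "\<dots> = (\<Sum>j\<in>UNIV. \<Sum>k\<in>UNIV. (if j = k then 1 else 0) * T (E j) (E k))"
  proof (intro sum.cong refl)
    fix j k
    have "g (E j) (E k) p = (\<Sum>i\<in>UNIV. g (E j) (F i) p * g (F i) (E k) p)"
      by (rule orthonormal_at_tensorial[OF tensorial_at_metric(1)[OF vE] F vE])
    then show "(\<Sum>i\<in>UNIV. g (E j) (F i) p * g (F i) (E k) p * T (E j) (E k)) = (if j = k then 1 else 0) * T (E j) (E k)"
      by (simp only: gE flip: sum_distrib_right)
  qed
  also have "\<dots> = (\<Sum>j\<in>UNIV. T (E j) (E j))"
    by (simp add: if_distrib[of "\<lambda>x. x * _"] cong: if_cong)
  finally show ?thesis .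
qed

text \<open>Provides a globally smooth normalising factor for Gram-Schmidt, correct near
  \<open>p\<close> only.\<close>

lemma smooth_powr_near:
  assumes f: "smooth_fun A f" and p: "f p > 0"
  obtains \<rho> N where "smooth_fun A \<rho>" "open N" "p \<in> N" "\<And>q. q \<in> N \<Longrightarrow> f q > 0"
    "\<And>q. q \<in> N \<Longrightarrow> \<rho> q = f q powr a"
proof -
  define M where "M = {q. f q > 0}"
  have M: "open M" "p \<in> M"
    using open_Collect_less[OF continuous_on_const smooth_fun_continuous[OF f]] p by (auto simp: M_def)
  obtain \<beta> C N where b: "smooth_fun A \<beta>" "closed C" "C \<subseteq> M" "\<And>q. q \<notin> C \<Longrightarrow> \<beta> q = 0"
    "open N" "p \<in> N" "N \<subseteq> C" "\<And>q. q \<in> N \<Longrightarrow> \<beta> q = 1"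
    by (rule bump_at[OF M]) blast
  have "smooth_in A M (\<lambda>q. f q powr a)"
    by (rule smooth_in_powr[OF M(1) _ smooth_fun_imp_smooth_in[OF f]]) (simp add: M_def)
  from smooth_fun_extend_by_zero[OF M(1) this b(2,3,1,4)]
  show thesis by (rule that[OF _ b(5,6)]) (use b(3,7,8) in \<open>auto simp: M_def\<close>)
qed

text \<open>Orthonormalisation by induction on the index set; the members of \<open>E\<close>
  outside \<open>S\<close> are unconstrained. The neighbourhood shrinks at each step to where the
  new vector stays nonzero.\<close>

lemma gram_schmidt:
  fixes S :: "'n set"
  shows "\<exists>E U. (\<forall>i. vector_field A (E i)) \<and> open U \<and> p \<in> U \<and>
    (\<forall>q\<in>U. \<forall>i\<in>S. \<forall>j\<in>S. g (E i) (E j) q = (if i = j then 1 else 0))"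
  using finite[of S]
proof (induction S rule: finite_induct)
  case empty
  show ?case by (intro exI[of _ "\<lambda>i h q. 0"] exI[of _ UNIV]) (simp add: vector_field_zero)
next
  case (insert k S)
  then obtain E U where E: "\<And>i. vector_field A (E i)" and U: "open U" "p \<in> U"
    and on: "\<And>q i j. q \<in> U \<Longrightarrow> i \<in> S \<Longrightarrow> j \<in> S \<Longrightarrow> g (E i) (E j) q = (if i = j then 1 else 0)"
    by blast
  obtain y :: "'n \<Rightarrow> 'a \<Rightarrow> real" and B where y: "\<And>i. smooth_fun A (y i)" and B: "\<And>i. vector_field A (B i)"
    and dual: "\<And>i j. B i (y j) p = (if i = j then 1 else 0)"
    by (rule coordinate_frame[of p]) blast
  define e :: "'n \<Rightarrow> real ^ 'n" where "e i = (\<chi> j. E i (y j) p)" for i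
  \<comment> \<open>Fewer than \<open>CARD('n)\<close> coordinate vectors cannot span, so some
    \<open>a\<close> lies outside their span; the field with constant components \<open>a\<close> is
    then independent of the earlier ones at \<open>p\<close>.\<close>
  have "dim (e ` S) \<le> card (e ` S)" by (rule dim_le_card') (simp add: insert.hyps)
  also have "\<dots> \<le> card S" by (rule card_image_le[OF insert.hyps(1)])
  also have "\<dots> < CARD('n)" using insert.hyps(2) by (intro psubset_card_mono) auto
  finally have "span (e ` S) \<noteq> UNIV" using dim_eq_full[of "e ` S"] by simp
  then obtain a where a: "a \<notin> span (e ` S)" by blast
  define X where "X = vf_lincomb UNIV (\<lambda>i q. a $ i) B"
  have X: "vector_field A X" unfolding X_def by (intro vector_field_vf_lincomb finite smooth_fun_const B)
  define W where "W = vf_diff X (vf_lincomb S (\<lambda>i. g X (E i)) E)"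
  have L: "vector_field A (vf_lincomb S (\<lambda>i. g X (E i)) E)"
    by (intro vector_field_vf_lincomb insert.hyps metric_smooth X E)
  have W: "vector_field A W" unfolding W_def by (intro vector_field_vf_diff X L)
  \<comment> \<open>If the orthogonal remainder vanished at \<open>p\<close>, reading it on the
    coordinate functions would put \<open>a\<close> into the span.\<close>
  have "nonzero_at W p"
  proof (rule ccontr)
    assume "\<not> nonzero_at W p"
    then have 0: "W (y j) p = 0" for j by (simp add: nonzero_at_def)
    have "X (y j) p = a $ j" for j
      by (simp add: X_def vf_lincomb_def dual if_distrib cong: if_cong)
    with 0 have "a $ j = (\<Sum>i\<in>S. g X (E i) p * E i (y j) p)" for j
      by (simp add: W_def vf_diff_def vf_lincomb_def)
    then have "a = (\<Sum>i\<in>S. g X (E i) p *\<^sub>R e i)" by (simp add: vec_eq_iff e_def)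
    also have "\<dots> \<in> span (e ` S)" by (intro span_sum span_scale span_base imageI)
    finally show False using a by simp
  qed
  then have "g W W p > 0" by (rule metric_pos[OF W])
  then obtain \<rho> N where r: "smooth_fun A \<rho>" "open N" "p \<in> N" "\<And>q. q \<in> N \<Longrightarrow> g W W q > 0"
    "\<And>q. q \<in> N \<Longrightarrow> \<rho> q = g W W q powr (- 1 / 2)"
    by (rule smooth_powr_near[OF metric_smooth[OF W W], of p "- 1 / 2"]) blast
  let ?F = "E(k := vf_scale \<rho> W)"
  have scale: "g (vf_scale \<rho> W) Y q = \<rho> q * g W Y q" "g Y (vf_scale \<rho> W) q = \<rho> q * g Y W q"
    if "vector_field A Y" for Y q
    using tensorial_atD(2)[OF tensorial_at_metric(1)[OF that] W r(1)]
      tensorial_atD(2)[OF tensorial_at_metric(2)[OF that] W r(1)] by auto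
  have WE: "g W (E j) q = 0" if "q \<in> U" "j \<in> S" for q j
  proof -
    have "g (vf_lincomb S (\<lambda>i. g X (E i)) E) (E j) q = (\<Sum>i\<in>S. g X (E i) q * g (E i) (E j) q)"
      by (rule tensorial_at_vf_lincomb[OF tensorial_at_metric(1)[OF E] insert.hyps(1) metric_smooth[OF X E] E])
    also have "\<dots> = g X (E j) q"
      using that insert.hyps(1) by (simp add: on if_distrib cong: if_cong)
    finally show ?thesis unfolding W_def
      by (simp add: tensorial_at_vf_diff[OF tensorial_at_metric(1)[OF E] X L])
  qed
  have WW: "\<rho> q * (\<rho> q * g W W q) = 1" if "q \<in> N" for q
  proof -
    have "\<rho> q * \<rho> q = g W W q powr (- 1)"
      using r(5)[OF that] by (simp flip: powr_add)
    then show ?thesis using r(4)[OF that] by (simp add: powr_minus field_simps)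
  qed
  have vF: "vector_field A (vf_scale \<rho> W)" by (rule vector_field_vf_scale[OF r(1) W])
  have "g (?F i) (?F j) q = (if i = j then 1 else 0)"
    if "q \<in> U \<inter> N" "i \<in> insert k S" "j \<in> insert k S" for q i j
    using that on[of q i j] WW[of q] WE[of q] insert.hyps(2)
    by (auto simp: scale vF W E metric_sym[OF E W])
  moreover have "vector_field A (?F i)" for i using E vF by simp
  moreover have "open (U \<inter> N)" "p \<in> U \<inter> N" using U r(2,3) by auto
  ultimately show ?case by blast
qed

lemma local_orthonormal_frame_exists: "\<exists>E. local_orthonormal_frame A g p E"
  using gram_schmidt[of p UNIV] unfolding local_orthonormal_frame_def by fast

text \<open>Names exactly the choice made inside \<open>divergence\<close> and
  \<open>norm_nabla_sq\<close>, so that both can be folded to it.\<close>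

definition frame_at :: "'a \<Rightarrow> 'n \<Rightarrow> 'a vfield" where
  "frame_at p = (SOME E. local_orthonormal_frame A g p E)"

lemma frame_at: "local_orthonormal_frame A g p (frame_at p)"
  unfolding frame_at_def using local_orthonormal_frame_exists by (rule someI_ex)

lemma frame_nhd:
  assumes "local_orthonormal_frame A g p E"
  obtains U where "open U" "p \<in> U" "\<And>q. q \<in> U \<Longrightarrow> orthonormal_at q E"
  using assms unfolding local_orthonormal_frame_def orthonormal_at_def by blast

lemma frame_at_orthonormal: "orthonormal_at p (frame_at p)"
  using frame_nhd[OF frame_at] by blast

text \<open>The frames \<open>frame_at p\<close> need not vary continuously with \<open>p\<close>.
  Near \<open>q\<close>, however, frame independence replaces all of them by the one frame
  \<open>frame_at q\<close>, for which the sum is visibly smooth.\<close>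

lemma trace_smooth:
  assumes T1: "\<And>Y p. vector_field A Y \<Longrightarrow> tensorial_at p (\<lambda>X. T X Y p)"
    and T2: "\<And>X p. vector_field A X \<Longrightarrow> tensorial_at p (\<lambda>Y. T X Y p)"
    and T: "\<And>X Y. vector_field A X \<Longrightarrow> vector_field A Y \<Longrightarrow> smooth_fun A (T X Y)"
  shows "smooth_fun A (\<lambda>p. \<Sum>i\<in>UNIV. T (frame_at p i) (frame_at p i) p)"
proof (rule smooth_fun_local)
  fix q
  obtain U where U: "open U" "q \<in> U" "\<And>r. r \<in> U \<Longrightarrow> orthonormal_at r (frame_at q)"
    by (rule frame_nhd[OF frame_at[of q]]) blast
  have v: "vector_field A (frame_at q i)" for i
    using U(2,3) by (auto simp: orthonormal_at_def)
  have "smooth_fun A (\<lambda>p. \<Sum>i\<in>UNIV. T (frame_at q i) (frame_at q i) p)"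
    by (intro smooth_fun_sum finite T v)
  then show "\<exists>N f'. open N \<and> q \<in> N \<and> smooth_in A N f' \<and>
      (\<forall>r\<in>N. (\<Sum>i\<in>UNIV. T (frame_at r i) (frame_at r i) r) = f' r)"
    using U(1,2) trace_frame_independent[OF T1 T2 U(3) frame_at_orthonormal]
    by (intro exI[of _ U] exI) (auto intro: smooth_fun_imp_smooth_in)
qed

text \<open>The sum defining the gradient does not depend on the orthonormal frame, so it is smooth near every
  point without a partition of unity.\<close>

lemma gradient_exists:
  assumes f: "smooth_fun A f"
  shows "\<exists>V. vector_field A V \<and> (\<forall>X. vector_field A X \<longrightarrow> g V X = X f)"
proof -
  define V where "V h q = (if smooth_fun A h then \<Sum>i\<in>UNIV. frame_at q i f q * frame_at q i h q else 0)" for h q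
  have E: "vector_field A (frame_at q i)" for q i
    using frame_at_orthonormal[of q] by (simp add: orthonormal_at_def)
  have V: "vector_field A V"
  proof (rule vector_fieldI)
    fix h assume h: "smooth_fun A h"
    \<comment> \<open>\<open>V h\<close> is the trace of the bilinear form that sends
      \<open>X\<close> and \<open>Y\<close> to the product of \<open>X f\<close> and
      \<open>Y h\<close>.\<close>
    have "smooth_fun A (\<lambda>p. \<Sum>i\<in>UNIV. (\<lambda>X Y q. X f q * Y h q) (frame_at p i) (frame_at p i) p)"
      by (rule trace_smooth)
        (simp_all add: tensorial_at_def vf_add_def vf_scale_def algebra_simps smooth_fun_mult vector_field_smooth f h)
    then show "smooth_fun A (V h)" using h by (simp add: V_def[abs_def])
  qed (simp_all add: V_def smooth_fun_add smooth_fun_mult smooth_fun_const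
      vector_field_add[OF E] vector_field_mult[OF E] vector_field_cmult[OF E] vector_field_const[OF E]
      algebra_simps sum.distrib sum_distrib_left)
  have "g V X q = X f q" if X: "vector_field A X" for X q
  proof -
    have "g V X q = (\<Sum>i\<in>UNIV. frame_at q i f q * g (frame_at q i) X q)"
      by (rule tensorial_at_eq_sum[OF tensorial_at_metric(1)[OF X] V E finite]) (simp add: V_def)
    also have "\<dots> = X f q"
      unfolding orthonormal_at_expand[OF frame_at_orthonormal X f, of q]
      by (simp add: metric_sym[OF E X] mult.commute)
    finally show ?thesis .
  qed
  then show ?thesis using V by blast
qed

lemma metric_nondegenerate:
  assumes V: "vector_field A V" "vector_field A W"
    and eq: "\<And>X. vector_field A X \<Longrightarrow> g V X = g W X"
  shows "V = W"
proof (intro ext)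
  fix h p
  have d: "vector_field A (vf_diff V W)" using V by (rule vector_field_vf_diff)
  have "g (vf_diff V W) (vf_diff V W) p = 0"
    using tensorial_at_vf_diff[OF tensorial_at_metric(1)[OF d] V, of p] eq[OF d] by simp
  then have "\<not> nonzero_at (vf_diff V W) p" using metric_pos[OF d, of p] by auto
  then show "V h p = W h p" by (simp add: nonzero_at_def vf_diff_def)
qed

lemma grad_unique:
  assumes "vector_field A V" "\<And>X. vector_field A X \<Longrightarrow> g V X = X f"
  shows "grad A g f = V"
  unfolding grad_def by (rule the_equality) (use assms metric_nondegenerate in auto)

lemma metric_grad:
  assumes "smooth_fun A f" "vector_field A X"
  shows "g (grad A g f) X = X f"
  using gradient_exists[OF assms(1)] grad_unique[of _ f] assms(2) by metis

end

section \<open>The Bochner formula\<close>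

locale levi_civita_manifold = riemannian_manifold A g
  for A :: "('a::t2_space, 'n::finite) chart set" and g :: "'a tensor2" +
  fixes D :: "'a vfield \<Rightarrow> 'a vfield \<Rightarrow> 'a vfield"
  assumes levi_civita: "levi_civita_connection A g D"
begin

lemma affine: "affine_connection A D"
  using levi_civita by (simp add: levi_civita_connection_def)

lemma connection_vector_field: "vector_field A X \<Longrightarrow> vector_field A Y \<Longrightarrow> vector_field A (D X Y)"
  using affine by (simp add: affine_connection_def)

lemma torsion_free:
  "vector_field A X \<Longrightarrow> vector_field A Y \<Longrightarrow> lie_bracket X Y = vf_diff (D X Y) (D Y X)"
  using levi_civita by (simp add: levi_civita_connection_def)

lemma vector_field_lie_bracket:
  "vector_field A X \<Longrightarrow> vector_field A Y \<Longrightarrow> vector_field A (lie_bracket X Y)"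
  by (simp add: torsion_free vector_field_vf_diff connection_vector_field)

lemma metric_compatible:
  "vector_field A X \<Longrightarrow> vector_field A Y \<Longrightarrow> vector_field A Z \<Longrightarrow>
    X (g Y Z) p = g (D X Y) Z p + g Y (D X Z) p"
  using levi_civita by (simp add: levi_civita_connection_def)

lemma tensorial_at_connection:
  assumes "vector_field A Y" "vector_field A Z"
  shows "tensorial_at p (\<lambda>X. g (D X Y) Z p)"
proof -
  have "D (vf_add X X') Y = vf_add (D X Y) (D X' Y)" if "vector_field A X" "vector_field A X'" for X X'
    using affine that assms(1) by (simp add: affine_connection_def)
  moreover have "D (vf_scale f X) Y = vf_scale f (D X Y)" if "smooth_fun A f" "vector_field A X" for f X
    using affine that assms(1) by (simp add: affine_connection_def)
  ultimately show ?thesis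
    using tensorial_at_metric(1)[OF assms(2)] assms
    by (simp add: tensorial_at_def connection_vector_field)
qed

lemma metric_vf_diff:
  "vector_field A X \<Longrightarrow> vector_field A Y \<Longrightarrow> vector_field A Z \<Longrightarrow>
    g (vf_diff X Y) Z p = g X Z p - g Y Z p"
  "vector_field A X \<Longrightarrow> vector_field A Y \<Longrightarrow> vector_field A Z \<Longrightarrow>
    g Z (vf_diff X Y) p = g Z X p - g Z Y p"
  using tensorial_at_vf_diff[OF tensorial_at_metric(1), of Z X Y p]
    tensorial_at_vf_diff[OF tensorial_at_metric(2), of Z X Y p] by auto

lemma divergence_eq:
  assumes V: "vector_field A V" and E: "orthonormal_at p E"
  shows "divergence A g D V p = (\<Sum>i\<in>UNIV. g (D (E i) V) (E i) p)"
proof -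
  have "(\<Sum>i\<in>UNIV. g (D (frame_at p i) V) (frame_at p i) p) = (\<Sum>i\<in>UNIV. g (D (E i) V) (E i) p)"
    by (rule trace_frame_independent[OF _ _ E frame_at_orthonormal])
      (simp_all add: tensorial_at_connection tensorial_at_metric connection_vector_field V)
  then show ?thesis by (simp add: divergence_def frame_at_def[symmetric])
qed

lemma norm_nabla_sq_eq:
  "norm_nabla_sq A g D V p = (\<Sum>i\<in>UNIV. g (D (frame_at p i) V) (D (frame_at p i) V) p)"
  by (simp add: norm_nabla_sq_def Let_def frame_at_def[symmetric])

text \<open>Vector fields return 0 on non-smooth functions, so the derivative of the divergence
  along \<open>V\<close> has its intended meaning only once this is known.\<close>

lemma divergence_smooth:
  assumes V: "vector_field A V"
  shows "smooth_fun A (divergence A g D V)"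
proof -
  have "smooth_fun A (\<lambda>p. \<Sum>i\<in>UNIV. (\<lambda>X Y. g (D X V) Y) (frame_at p i) (frame_at p i) p)"
    by (rule trace_smooth)
      (simp_all add: tensorial_at_connection tensorial_at_metric connection_vector_field V metric_smooth)
  then show ?thesis by (simp add: divergence_def frame_at_def[symmetric] Let_def)
qed

text \<open>The Hessian of a function is symmetric because the connection is torsion-free.\<close>

lemma connection_gradient_sym:
  assumes f: "smooth_fun A f" and V: "vector_field A V" "\<And>X. vector_field A X \<Longrightarrow> g V X = X f"
    and X: "vector_field A X" and Y: "vector_field A Y"
  shows "g (D X V) Y p = g (D Y V) X p"
proof -
  \<comment> \<open>The Hessian of \<open>f\<close> as a second derivative with its connection
    correction; its skew part is the bracket minus the torsion-free expression for it.\<close>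
  have 1: "g (D X V) Y p = X (Y f) p - D X Y f p" if "vector_field A X" "vector_field A Y" for X Y
    using metric_compatible[OF that(1) V(1) that(2), of p]
    by (simp add: V(2) that connection_vector_field)
  have "D X Y f p - D Y X f p = X (Y f) p - Y (X f) p"
    using torsion_free[OF X Y] by (simp add: vf_diff_def lie_bracket_def fun_eq_iff)
  then show ?thesis by (simp add: 1 X Y)
qed

text \<open>The left side is Ric(V, V). Fixing \<open>E\<close> as \<open>frame_at p\<close> makes
  \<open>norm_nabla_sq\<close> an unfolding, while the divergences may be taken in any frame. For
  each \<open>i\<close> the mixed term \<open>g (D (E i) V) (D V (E i))\<close> arises twice, from
  pulling \<open>V\<close> out of the metric and from the bracket; both copies disappear in the
  sum.\<close>

lemma bochner:
  assumes f: "smooth_fun A f" and V: "vector_field A V" "\<And>X. vector_field A X \<Longrightarrow> g V X = X f"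
    and E: "E = frame_at p"
  shows "(\<Sum>i\<in>UNIV. riemann_tensor g D (E i) V V (E i) p) =
    laplacian A g D (g V V) p / 2 - norm_nabla_sq A g D V p - V (divergence A g D V) p"
proof -
  have sym: "g (D X V) Y q = g (D Y V) X q" if "vector_field A X" "vector_field A Y" for X Y q
    by (rule connection_gradient_sym[OF f V that])
  note cv = connection_vector_field
  obtain U where U: "open U" "p \<in> U" "\<And>q. q \<in> U \<Longrightarrow> orthonormal_at q E"
    unfolding E by (rule frame_nhd[OF frame_at[of p]]) blast
  have vE: "vector_field A (E i)" for i using U(2,3) by (auto simp: orthonormal_at_def)
  have lap: "laplacian A g D (g V V) p = 2 * (\<Sum>i\<in>UNIV. g (D (E i) (D V V)) (E i) p)"
  proof -
    \<comment> \<open>Twice \<open>D V V\<close>, written as a sum so that additivity of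
      \<open>D\<close> and \<open>g\<close> is enough. It is the gradient of |V|^2 because Hessian
      symmetry exchanges \<open>V\<close> and \<open>X\<close> in
      \<open>g (D V V) X\<close>.\<close>
    let ?W = "vf_add (D V V) (D V V)"
    have W: "vector_field A ?W" by (intro vector_field_vf_add cv V(1))
    have "g ?W X = X (g V V)" if X: "vector_field A X" for X
    proof
      fix q
      have "g ?W X q = 2 * g (D V V) X q"
        using tensorial_atD(1)[OF tensorial_at_metric(1)[OF X, of q], of "D V V" "D V V"]
        by (simp add: cv V(1))
      also have "\<dots> = g (D X V) V q + g V (D X V) q"
        using sym[OF V(1) X] metric_sym[OF cv[OF X V(1)] V(1)] by simp
      finally show "g ?W X q = X (g V V) q" by (simp add: metric_compatible X V(1))
    qed
    then have "grad A g (g V V) = ?W" by (intro grad_unique W)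
    then have "laplacian A g D (g V V) p = (\<Sum>i\<in>UNIV. g (D (E i) ?W) (E i) p)"
      using divergence_eq[OF W U(3)[OF U(2)]] by (simp add: laplacian_def)
    moreover have "g (D (E i) ?W) (E i) p = 2 * g (D (E i) (D V V)) (E i) p" for i
    proof -
      have "D (E i) ?W = vf_add (D (E i) (D V V)) (D (E i) (D V V))"
        using affine by (simp add: affine_connection_def cv V(1) vE)
      then show ?thesis
        using tensorial_atD(1)[OF tensorial_at_metric(1)[OF vE, of p]] by (simp add: cv V(1) vE)
    qed
    ultimately show ?thesis by (simp add: sum_distrib_left)
  qed
  have div: "V (divergence A g D V) p = (\<Sum>i\<in>UNIV. V (g (D (E i) V) (E i)) p)"
  proof -
    have s: "smooth_fun A (g (D (E i) V) (E i))" for i by (intro metric_smooth cv vE V(1))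
    \<comment> \<open>The divergence is computed in the fixed frame \<open>E\<close> only for points
      near \<open>p\<close>, which suffices because \<open>V\<close> is local.\<close>
    have "V (divergence A g D V) p = V (\<lambda>q. \<Sum>i\<in>UNIV. g (D (E i) V) (E i) q) p"
      by (rule vector_field_local[OF V(1) divergence_smooth[OF V(1)] smooth_fun_sum[OF finite s] U(1,2)])
        (rule divergence_eq[OF V(1) U(3)])
    then show ?thesis by (simp add: vector_field_sum[OF V(1) finite s])
  qed
  \<comment> \<open>the trace of a symmetric against a skew-symmetric matrix\<close>
  have skew: "(\<Sum>i\<in>UNIV. g (D (E i) V) (D V (E i)) p) = 0"
  proof -
    let ?S = "\<lambda>i j. g (D (E i) V) (E j) p" and ?K = "\<lambda>i j. g (D V (E i)) (E j) p"
    \<comment> \<open>The inner products of the frame are constant near \<open>p\<close>, so their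
      derivative along \<open>V\<close> vanishes; metric compatibility turns this into
      skewness.\<close>
    have K: "?K i j = - ?K j i" for i j
    proof -
      have "V (g (E i) (E j)) p = V (\<lambda>q. if i = j then 1 else 0) p"
        by (rule vector_field_local[OF V(1) metric_smooth[OF vE vE] smooth_fun_const U(1,2)])
          (use U(3) in \<open>auto simp: orthonormal_at_def\<close>)
      then have "g (D V (E i)) (E j) p + g (E i) (D V (E j)) p = 0"
        using metric_compatible[OF V(1) vE vE, of i j p] vector_field_const[OF V(1)] by simp
      then show ?thesis using metric_sym[OF vE cv[OF V(1) vE], of i j p] by simp
    qed
    have "g (D (E i) V) (D V (E i)) p = (\<Sum>j\<in>UNIV. ?S i j * ?K i j)" for i
      using orthonormal_at_tensorial[OF tensorial_at_metric(1)[OF cv[OF V(1) vE]] U(3)[OF U(2)] cv[OF vE V(1)]]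
        metric_sym[OF vE cv[OF V(1) vE]] by simp
    then have eq: "(\<Sum>i\<in>UNIV. g (D (E i) V) (D V (E i)) p) = (\<Sum>i\<in>UNIV. \<Sum>j\<in>UNIV. ?S i j * ?K i j)"
      by simp
    have "(\<Sum>i\<in>UNIV. \<Sum>j\<in>UNIV. ?S i j * ?K i j) = (\<Sum>i\<in>UNIV. \<Sum>j\<in>UNIV. ?S j i * ?K j i)"
      by (rule sum.swap)
    also have "\<dots> = (\<Sum>i\<in>UNIV. \<Sum>j\<in>UNIV. - (?S i j * ?K i j))"
    proof (intro sum.cong refl)
      fix i j
      show "?S j i * ?K j i = - (?S i j * ?K i j)"
        using sym[OF vE vE, of i j p] K[of i j] by simp
    qed
    also have "\<dots> = - (\<Sum>i\<in>UNIV. \<Sum>j\<in>UNIV. ?S i j * ?K i j)"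
      by (simp add: sum_negf)
    finally show ?thesis using eq by simp
  qed
  have "riemann_tensor g D (E i) V V (E i) p =
      g (D (E i) (D V V)) (E i) p - V (g (D (E i) V) (E i)) p
        - g (D (E i) V) (D (E i) V) p + 2 * g (D (E i) V) (D V (E i)) p" for i
  proof -
    let ?B = "lie_bracket (E i) V"
    have B: "vector_field A ?B" by (intro vector_field_lie_bracket vE V(1))
    have "riemann_tensor g D (E i) V V (E i) p =
        g (D (E i) (D V V)) (E i) p - g (D V (D (E i) V)) (E i) p - g (D ?B V) (E i) p"
      by (simp add: riemann_tensor_def curvature_def metric_vf_diff vector_field_vf_diff cv vE V(1) B)
    moreover have "g (D V (D (E i) V)) (E i) p = V (g (D (E i) V) (E i)) p - g (D (E i) V) (D V (E i)) p"
      using metric_compatible[OF V(1) cv[OF vE V(1)] vE, of i i p] by simp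
    \<comment> \<open>Hessian symmetry moves the bracket into the second slot, where it is
      \<open>D (E i) V\<close> minus \<open>D V (E i)\<close>: this yields the contribution to
      |\<nabla>V|^2 and the second mixed term.\<close>
    moreover have "g (D ?B V) (E i) p = g (D (E i) V) (D (E i) V) p - g (D (E i) V) (D V (E i)) p"
      using sym[OF B vE, of i p]
      by (simp add: torsion_free[OF vE V(1)] metric_vf_diff cv vE V(1))
    ultimately show ?thesis by simp
  qed
  then show ?thesis
    using lap div skew
    by (simp add: E norm_nabla_sq_eq sum.distrib sum_subtractf flip: sum_distrib_left)
qed

section \<open>Trace of the soliton equation\<close>

text \<open>The derivatives along \<open>V\<close> produced by metric compatibility cancel those in
  the two brackets.\<close>

lemma lie_derivative2_metric:
  assumes "vector_field A V" "vector_field A X" "vector_field A Y"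
  shows "lie_derivative2 V g X Y p = g (D X V) Y p + g X (D Y V) p"
  using assms
  by (simp add: lie_derivative2_def metric_compatible torsion_free metric_vf_diff connection_vector_field)

text \<open>For a gradient field half the Lie derivative of \<open>g\<close> is the Hessian. On the
  right, |V|^2 is counted n times and the squared components of \<open>V\<close> remove it once,
  giving n - 1. On the left, \<open>g (D V V) V\<close>, which is half of V(|V|^2), is counted n
  times and removed twice by the mixed Kulkarni-Nomizu terms, giving n - 2.\<close>

lemma soliton_contraction:
  assumes f: "smooth_fun A f" and V: "vector_field A V" "\<And>X. vector_field A X \<Longrightarrow> g V X = X f"
    and sol: "almost_riemann_soliton A g D V lam" and E: "orthonormal_at p E"
  shows "(real CARD('n) - 1) * lam p * g V V p = divergence A g D V p * g V V p
    + (real CARD('n) - 2) * (V (g V V) p / 2) + (\<Sum>i\<in>UNIV. riemann_tensor g D (E i) V V (E i) p)"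
proof -
  have sym: "g (D X V) Y q = g (D Y V) X q" if "vector_field A X" "vector_field A Y" for X Y q
    by (rule connection_gradient_sym[OF f V that])
  have vE: "vector_field A (E i)" and gE: "g (E i) (E i) p = 1" for i
    using E by (auto simp: orthonormal_at_def)
  note cv = connection_vector_field[OF _ V(1)]
  let ?a = "g (D V V) V p"
  \<comment> \<open>Parseval's identity; it evaluates both mixed sums, for \<open>X = V\<close> and
    for \<open>X = D V V\<close>.\<close>
  have expand: "(\<Sum>i\<in>UNIV. g X (E i) p * g V (E i) p) = g X V p" if "vector_field A X" for X
    using orthonormal_at_tensorial[OF tensorial_at_metric(1)[OF V(1)] E that]
      metric_sym[OF V(1) vE] by simp
  have "1/2 * kulkarni_nomizu (lie_derivative2 V g) g (E i) V V (E i) p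
      = g (D (E i) V) (E i) p * g V V p + ?a - 2 * (g (D V V) (E i) p * g V (E i) p)" for i
    using sym[OF vE V(1), of i p] metric_sym[OF vE cv[OF vE], of i i p]
      metric_sym[OF V(1) cv[OF V(1)], of p] metric_sym[OF vE cv[OF V(1)], of i p]
      metric_sym[OF V(1) cv[OF vE], of i p] metric_sym[OF V(1) vE, of i p]
    by (simp add: kulkarni_nomizu_def lie_derivative2_metric V(1) vE gE algebra_simps)
  moreover have "1/2 * kulkarni_nomizu g g (E i) V V (E i) p = g V V p - g V (E i) p * g V (E i) p" for i
    using metric_sym[OF V(1) vE, of i p] by (simp add: kulkarni_nomizu_def gE)
  ultimately have R: "riemann_tensor g D (E i) V V (E i) p =
      lam p * (g V V p - g V (E i) p * g V (E i) p)
      - (g (D (E i) V) (E i) p * g V V p + ?a - 2 * (g (D V V) (E i) p * g V (E i) p))" for i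
    using sol unfolding almost_riemann_soliton_def by (metis V(1) vE add_diff_cancel_left')
  have "(\<Sum>i\<in>UNIV. riemann_tensor g D (E i) V V (E i) p) =
      lam p * (real CARD('n) * g V V p - g V V p)
      - (divergence A g D V p * g V V p + real CARD('n) * ?a - 2 * ?a)"
    unfolding R
    by (simp add: sum_subtractf sum.distrib expand[OF V(1)] expand[OF cv[OF V(1)]] divergence_eq[OF V(1) E]
        flip: sum_distrib_left sum_distrib_right)
  moreover have "V (g V V) p = 2 * ?a"
    using metric_compatible[OF V(1) V(1) V(1), of p] metric_sym[OF V(1) cv[OF V(1)], of p] by simp
  ultimately show ?thesis by (simp add: algebra_simps)
qed

end

theorem theorem2p3:
  fixes A :: "('a::{t2_space, second_countable_topology}, 'n::finite) chart set"
    and g :: "'a tensor2"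
    and D :: "'a vfield \<Rightarrow> 'a vfield \<Rightarrow> 'a vfield"
    and V :: "'a vfield"
    and lam :: "'a \<Rightarrow> real"
    and n :: real
  assumes "smooth_atlas A"
    and "riemannian_metric A g"
    and "levi_civita_connection A g D"
    and "n = real CARD('n)"
    and "CARD('n) \<ge> 3"
    and "gradient_almost_riemann_soliton A g D V lam"
  shows "\<forall>p. lam p =
    1 / (2 * (n - 1) * g V V p) *
      (laplacian A g D (g V V) p - 2 * norm_nabla_sq A g D V p
        + (n - 2) * V (g V V) p - 2 * V (divergence A g D V) p)
    + 1 / (n - 1) * divergence A g D V p"
proof
  fix p
  interpret levi_civita_manifold A g D
    by unfold_locales (rule assms)+
  have sol: "almost_riemann_soliton A g D V lam"
    using assms(6) by (simp add: gradient_almost_riemann_soliton_def)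
  then have V: "vector_field A V" and nz: "nonzero_at V p"
    by (auto simp: almost_riemann_soliton_def)
  obtain f where f: "smooth_fun A f" and Vf: "V = grad A g f"
    using assms(6) by (auto simp: gradient_almost_riemann_soliton_def)
  have gV: "g V X = X f" if "vector_field A X" for X
    unfolding Vf by (rule metric_grad[OF f that])
  have pos: "g V V p > 0" by (rule metric_pos[OF V nz])
  have n: "n - 1 > 0" using assms(4,5) by simp
  have main: "(n - 1) * lam p * g V V p = divergence A g D V p * g V V p + (n - 2) * (V (g V V) p / 2)
      + (laplacian A g D (g V V) p / 2 - norm_nabla_sq A g D V p - V (divergence A g D V) p)"
    using soliton_contraction[OF f V gV sol frame_at_orthonormal, of p]
      bochner[OF f V gV refl, of p] by (simp add: assms(4))
  \<comment> \<open>Division by (n - 1) |V|^2, which is positive because the dimension is at least 3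
    and \<open>V\<close> has no zeros. Real variables replace the geometric terms to keep this pure
    field arithmetic.\<close>
  have alg: "x = 1 / (2 * m * G) * (L - 2 * N + B - 2 * Y) + 1 / m * d"
    if "m * x * G = d * G + B / 2 + (L / 2 - N - Y)" "m > 0" "G > 0" for x m G L N B Y d :: real
  proof -
    have "x = (d * G + B / 2 + (L / 2 - N - Y)) / (m * G)"
      using that by (simp add: eq_divide_eq mult_ac)
    then show ?thesis using that(2,3) by (simp add: field_simps)
  qed
  show "lam p =
    1 / (2 * (n - 1) * g V V p) *
      (laplacian A g D (g V V) p - 2 * norm_nabla_sq A g D V p
        + (n - 2) * V (g V V) p - 2 * V (divergence A g D V) p)
    + 1 / (n - 1) * divergence A g D V p"
    by (rule alg[OF _ n pos]) (use main in simp)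
qed

end
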